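(* Let $G\in\mathbb{U}_D^{\gamma}$ be optimal, i.e. $W(G)\le W(H)$ for all $H\in\mathbb{U}_D^{\gamma}$. If $\gamma=2k$, the vertices of the cycle of $G$ can be labelled $u_1,\dots,u_k,w_1,\dots,w_k$ so that the cycle is $u_1w_1w_2\cdots w_ku_ku_{k-1}\cdots u_2u_1$, $U_1$ has the maximum number of vertices among the trees attached at cycle vertices, and \[|V(U_1)|\ge|V(W_1)|\ge|V(U_2)|\ge|V(W_2)|\ge\cdots\ge|V(U_k)|\ge|V(W_k)|.\] If $\gamma=2k-1$, the vertices of the cycle can be labelled $u_1,\dots,u_k,w_1,\dots,w_{k-1}$ so that the cycle is $u_1w_1\cdots w_{k-1}u_ku_{k-1}\cdots u_2u_1$, $U_1$ has the maximum number of vertices, and \[|V(U_1)|\ge|V(W_1)|\ge|V(U_2)|\ge\cdots\ge|V(U_{k-1})|\ge|V(W_{k-1})|\ge|V(U_k)|.\]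
   Context: All graphs are finite, simple, undirected. A unicyclic graph is a connected graph with exactly one cycle; its girth $\gamma$ is the length of the cycle. $\mathbb{U}_D^{\gamma}$ is the set of unicyclic graphs with degree sequence $D$ and girth $\gamma$. $W(G)=\sum_{\{u,v\}}d_G(u,v)$ over unordered vertex pairs. For a cycle vertex $x$, the tree attached at $x$ is the connected component containing $x$ of the graph obtained from $G$ by deleting the edges of the cycle; $U_i$ and $W_i$ denote the trees attached at $u_i$ and $w_i$. *)

theory Defs
  imports "Graph_Theory.Graph_Theory" "HOL-Library.Multiset"
begin

text \<open>
  A finite simple undirected graph is a \<^locale>\<open>pair_graph\<close>: a finite, loop-free digraph whose
  arcs are pairs of vertices and form a symmetric relation. Each undirected edge is thus
  represented by its two orientations, and the degree of a vertex is its out-degree.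
\<close>

definition gdist :: "'a pair_pre_digraph \<Rightarrow> 'a \<Rightarrow> 'a \<Rightarrow> nat" where
  "gdist G u v = (LEAST n. \<exists>p. vwalk p (with_proj G) \<and> hd p = u \<and> last p = v \<and> vwalk_length p = n)"

definition wiener_index :: "'a pair_pre_digraph \<Rightarrow> nat" where
  "wiener_index G =
     (\<Sum>P | P \<subseteq> pverts G \<and> card P = 2. THE d. \<exists>u v. P = {u, v} \<and> d = gdist G u v)"

text \<open>
  A cycle is given by the list of its vertices in cyclic order, without repeating the first one.
  The length condition is needed because a symmetric digraph has closed walks \<open>a, b, a\<close>,
  which are not cycles of the undirected graph.
\<close>

definition is_cycle :: "'a pair_pre_digraph \<Rightarrow> 'a list \<Rightarrow> bool" where
  "is_cycle G c \<longleftrightarrow> 3 \<le> length c \<and> distinct c \<and> vwalk (c @ [hd c]) (with_proj G)"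

text \<open>
  Different vertex lists (rotations, reversals) describe the same cycle. As a subgraph, a cycle
  is determined by its set of edges, that is, by the symmetric closure of its arcs.
\<close>

definition cycle_edges :: "'a list \<Rightarrow> 'a rel" where
  "cycle_edges c = (set (vwalk_arcs (c @ [hd c])))\<^sup>s"

definition cycles :: "'a pair_pre_digraph \<Rightarrow> 'a rel set" where
  "cycles G = {cycle_edges c | c. is_cycle G c}"

definition unicyclic :: "'a pair_pre_digraph \<Rightarrow> bool" where
  "unicyclic G \<longleftrightarrow> pair_graph G \<and> connected (with_proj G) \<and> (\<exists>!C. C \<in> cycles G)"

definition the_cycle :: "'a pair_pre_digraph \<Rightarrow> 'a rel" where
  "the_cycle G = (THE C. C \<in> cycles G)"

definition girth :: "'a pair_pre_digraph \<Rightarrow> nat" where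
  "girth G = (THE n. \<exists>c. is_cycle G c \<and> length c = n)"

text \<open>The order in which the degrees are listed in \<open>D\<close> is irrelevant.\<close>

definition has_degree_sequence :: "'a pair_pre_digraph \<Rightarrow> nat list \<Rightarrow> bool" where
  "has_degree_sequence G D \<longleftrightarrow>
     image_mset (out_degree (with_proj G)) (mset_set (pverts G)) = mset D"

definition unicyclic_graphs :: "nat list \<Rightarrow> nat \<Rightarrow> 'a pair_pre_digraph set" where
  "unicyclic_graphs D \<gamma> = {G. unicyclic G \<and> has_degree_sequence G D \<and> girth G = \<gamma>}"

definition delete_cycle :: "'a pair_pre_digraph \<Rightarrow> 'a pair_pre_digraph" where
  "delete_cycle G = \<lparr>pverts = pverts G, parcs = parcs G - the_cycle G\<rparr>"

text \<open>In a symmetric digraph, strongly connected components are the connected components.\<close>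

definition attached_tree :: "'a pair_pre_digraph \<Rightarrow> 'a \<Rightarrow> ('a, 'a \<times> 'a) pre_digraph" where
  "attached_tree G x =
     with_proj (delete_cycle G) \<restriction> pre_digraph.scc_of (with_proj (delete_cycle G)) x"

definition tree_order :: "'a pair_pre_digraph \<Rightarrow> 'a \<Rightarrow> nat" where
  "tree_order G x = card (verts (attached_tree G x))"

end

(*
  Deleting the cycle leaves a forest whose components are the attached trees. Joining their roots
  by a cycle in any other order gives a unicyclic graph with the same degrees and girth, and its
  Wiener index differs from that of G only in the sum of a_i a_j d(i,j) over cycle positions i, j,
  where a_i is the order of the tree at position i and d is the distance on the cycle. If a
  minimises this sum, then for every reflection of the cycle all larger trees of mirror pairs lie
  on the same side of the axis: otherwise exchanging the trees of some mirror pairs (polarisation)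
  would decrease the sum. The two reflections i -> -i and i -> 1 - i yield the chain
  a_0 >= a_1 >= a_(-1) >= a_2 >= ..., provided that the sides are the right ones. This is
  achieved by taking, among all rotations and reflections of the cycle, a labelling that maximises
  a sum with weights decreasing along the chain.
*)
theory Submission
  imports Defs
begin

section \<open>Distances as minimal relational powers\<close>

text \<open>For each axis the exchange argument leaves open which side carries the larger trees.
  Turning the cycle over to repair one axis may spoil the other, so the sides cannot be corrected
  one after the other. A labelling that maximises a single potential settles both: for either
  reflection the favoured side consists of the positions whose weight exceeds that of their mirror
  image, so larger trees on the other side would make the reflected labelling strictly better.

  The graph part keeps a forest \<open>F\<close> with its root map \<open>r\<close> fixed and lets
  only the list \<open>c\<close> of roots vary, so that whatever does not depend on \<open>c\<close>
  cancels when two graphs are compared. Distances are least exponents of relation powers, because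
  they are needed for the forest, for the cycle and for their union alike.\<close>

definition rdist :: "'a rel \<Rightarrow> 'a \<Rightarrow> 'a \<Rightarrow> nat" where
  "rdist R x y = (LEAST n. (x, y) \<in> R ^^ n)"

lemma rdist_le: "(x, y) \<in> R ^^ n \<Longrightarrow> rdist R x y \<le> n"
  unfolding rdist_def by (rule Least_le)

lemma relpow_rdist: "(x, y) \<in> R\<^sup>* \<Longrightarrow> (x, y) \<in> R ^^ rdist R x y"
  unfolding rdist_def by (rule LeastI_ex) (simp add: rtrancl_imp_relpow)

lemma rdist_refl [simp]: "rdist R x x = 0"
  using rdist_le[of x x 0 R] by simp

lemma rdist_step: "(x, y) \<in> R\<^sup>* \<Longrightarrow> (y, z) \<in> R \<Longrightarrow> rdist R x z \<le> Suc (rdist R x y)"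
  by (rule rdist_le, rule relpow_Suc_I[OF relpow_rdist])

lemma sym_relpow: "sym R \<Longrightarrow> sym (R ^^ n)"
proof (induction n)
  case (Suc n)
  show ?case
  proof (rule symI)
    fix x y assume "(x, y) \<in> R ^^ Suc n"
    then obtain z where z: "(x, z) \<in> R ^^ n" "(z, y) \<in> R" by auto
    show "(y, x) \<in> R ^^ Suc n"
      by (rule relpow_Suc_I2[OF symD[OF Suc.prems z(2)] symD[OF Suc.IH[OF Suc.prems] z(1)]])
  qed
qed (simp add: sym_Id)

lemma rdist_commute: "sym R \<Longrightarrow> rdist R x y = rdist R y x"
proof -
  assume "sym R"
  then have "(x, y) \<in> R ^^ n \<longleftrightarrow> (y, x) \<in> R ^^ n" for n
    by (intro iffI; rule symD[OF sym_relpow])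
  then show ?thesis unfolding rdist_def by simp
qed

text \<open>A function that vanishes at \<open>x\<close> and grows by at most one along each arc
  bounds the distance from \<open>x\<close> from below; a walk of length \<open>f y\<close> gives
  the other bound. This certificate serves both for the cycle and for the completed graph.\<close>

lemma rdist_eqI:
  assumes "(x, y) \<in> R ^^ f y" and "f x = 0"
    and lip: "\<And>u v. (u, v) \<in> R \<Longrightarrow> f v \<le> Suc (f u)"
  shows "rdist R x y = f y"
proof (rule antisym)
  show "rdist R x y \<le> f y" by (rule rdist_le) fact
  have "(x, z) \<in> R ^^ n \<Longrightarrow> f z \<le> n" for z n
  proof (induction n arbitrary: z)
    case (Suc n)
    then obtain u where "(x, u) \<in> R ^^ n" "(u, z) \<in> R" by auto
    then show ?case using Suc.IH[of u] lip[of u z] by linarith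
  qed (simp add: assms(2))
  moreover have "(x, y) \<in> R ^^ rdist R x y"
    by (rule relpow_rdist[OF relpow_imp_rtrancl[OF assms(1)]])
  ultimately show "f y \<le> rdist R x y" .
qed

section \<open>Relational descriptions of graphs, connectedness and the Wiener index\<close>

lemma pair_graph_iff:
  "pair_graph G \<longleftrightarrow> finite (pverts G) \<and> parcs G \<subseteq> pverts G \<times> pverts G \<and> sym (parcs G) \<and>
    (\<forall>x. (x, x) \<notin> parcs G)" (is "_ \<longleftrightarrow> ?R")
proof
  assume "pair_graph G"
  then show ?R
    by (force simp: pair_graph_def pair_digraph_def pair_pseudo_graph_def pair_fin_digraph_def
        pair_fin_digraph_axioms_def pair_sym_digraph_def pair_sym_digraph_axioms_def symmetric_def
        pair_loopfree_digraph_def pair_loopfree_digraph_axioms_def pair_wf_digraph_def)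
next
  assume R: ?R
  then have "finite (parcs G)" using finite_subset[of "parcs G" "pverts G \<times> pverts G"] by simp
  with R show "pair_graph G"
    by (auto simp: pair_graph_def pair_digraph_def pair_pseudo_graph_def pair_fin_digraph_def
        pair_fin_digraph_axioms_def pair_sym_digraph_def pair_sym_digraph_axioms_def symmetric_def
        pair_loopfree_digraph_def pair_loopfree_digraph_axioms_def pair_wf_digraph_def)
qed

lemma pair_graph_wf: "pair_graph G \<Longrightarrow> pair_wf_digraph G"
  by (simp add: pair_graph_def pair_digraph_def pair_fin_digraph_def)

lemma pair_graph_sym: "pair_graph G \<Longrightarrow> (x, y) \<in> parcs G \<Longrightarrow> (y, x) \<in> parcs G"
  unfolding pair_graph_iff by (blast dest: symD)

lemma rtrancl_on_iff_rtrancl: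
  assumes "R \<subseteq> V \<times> V" "u \<in> V"
  shows "(u, v) \<in> rtrancl_on V R \<longleftrightarrow> (u, v) \<in> R\<^sup>*"
proof
  assume uv: "(u, v) \<in> R\<^sup>*"
  then have "v \<in> V" using assms by (cases rule: rtrancl.cases) auto
  then show "(u, v) \<in> rtrancl_on V R"
    by (rule rtrancl_consistent_rtrancl_on[OF uv assms(2)]) (use assms(1) in auto)
qed (rule rtrancl_on_rtranclI)

lemma connected_iff:
  assumes "pair_graph G"
  shows "connected (with_proj G) \<longleftrightarrow>
    pverts G \<noteq> {} \<and> (\<forall>u \<in> pverts G. \<forall>v \<in> pverts G. (u, v) \<in> (parcs G)\<^sup>*)"
proof -
  have "parcs (mk_symmetric (with_proj G)) = parcs G"
    using pair_graph_sym[OF assms] by (auto simp: parcs_mk_symmetric)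
  moreover have "parcs G \<subseteq> pverts G \<times> pverts G" using assms by (simp add: pair_graph_iff)
  ultimately show ?thesis
    by (simp add: connected_def strongly_connected_def reachable_def rtrancl_on_iff_rtrancl)
qed

lemma vwalk_iff_relpow:
  assumes "pair_wf_digraph G" "u \<in> pverts G"
  shows "(\<exists>p. vwalk p (with_proj G) \<and> hd p = u \<and> last p = v \<and> vwalk_length p = n)
    \<longleftrightarrow> (u, v) \<in> parcs G ^^ n"
  using assms(2)
proof (induction n arbitrary: u)
  case 0
  have "vwalk p (with_proj G) \<and> hd p = u \<and> last p = v \<and> vwalk_length p = 0 \<longleftrightarrow> p = [u] \<and> u = v"
    for p using 0 by (cases p; cases "tl p") (auto simp: vwalk_def)
  then show ?case by auto
next
  case (Suc n)
  show ?case
  proof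
    assume "\<exists>p. vwalk p (with_proj G) \<and> hd p = u \<and> last p = v \<and> vwalk_length p = Suc n"
    then obtain p where p: "vwalk p (with_proj G)" "hd p = u" "last p = v" "vwalk_length p = Suc n"
      by blast
    then obtain x q where pq: "p = u # x # q"
      by (cases p; cases "tl p") auto
    have "vwalk (x # q) (with_proj G)" "(u, x) \<in> parcs G" "x \<in> pverts G"
      using p pq by (auto simp: vwalk_def)
    then have "(x, v) \<in> parcs G ^^ n"
      using Suc.IH[of x] p pq by (auto intro!: exI[of _ "x # q"])
    then show "(u, v) \<in> parcs G ^^ Suc n"
      using \<open>(u, x) \<in> parcs G\<close> by (blast intro: relpow_Suc_I2)
  next
    assume "(u, v) \<in> parcs G ^^ Suc n"
    then obtain x where x: "(u, x) \<in> parcs G" "(x, v) \<in> parcs G ^^ n"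
      by (blast dest: relpow_Suc_D2)
    then have "x \<in> pverts G" using assms(1) by (auto dest: pair_wf_digraph.in_arcsD2)
    with x Suc.IH obtain p where p: "vwalk p (with_proj G)" "hd p = x" "last p = v"
      "vwalk_length p = n" by blast
    then have "vwalk (u # p) (with_proj G)" using x Suc.prems by (auto intro: vwalk_consI)
    with p show "\<exists>p. vwalk p (with_proj G) \<and> hd p = u \<and> last p = v \<and> vwalk_length p = Suc n"
      by (intro exI[of _ "u # p"]) (auto simp: vwalk_def Suc_diff_le Suc_leI)
  qed
qed

lemma gdist_eq_rdist:
  assumes "pair_wf_digraph G" "u \<in> pverts G"
  shows "gdist G u v = rdist (parcs G) u v"
  unfolding gdist_def rdist_def using vwalk_iff_relpow[OF assms] by simp

text \<open>Each two-element set comes from exactly two ordered pairs, and the diagonal contributes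
  zero. Symmetry of the distance makes the \<open>THE\<close> in the definition well defined. The
  ordered form can later be regrouped by roots.\<close>

lemma wiener_index_double_sum:
  assumes "pair_graph G"
  shows "2 * wiener_index G = (\<Sum>x \<in> pverts G. \<Sum>y \<in> pverts G. rdist (parcs G) x y)"
proof -
  let ?V = "pverts G" and ?d = "rdist (parcs G)"
  have fin: "finite ?V" and sym: "sym (parcs G)" using assms by (simp_all add: pair_graph_iff)
  have comm: "?d x y = ?d y x" for x y by (rule rdist_commute[OF sym])
  let ?S = "{p \<in> ?V \<times> ?V. fst p \<noteq> snd p}" and ?T = "{P. P \<subseteq> ?V \<and> card P = 2}"
  let ?g = "\<lambda>(x, y). {x, y}"
  have inner: "(\<Sum>p \<in> {p \<in> ?S. ?g p = P}. case_prod ?d p)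
      = 2 * (THE d. \<exists>u v. P = {u, v} \<and> d = gdist G u v)" if P: "P \<in> ?T" for P
  proof -
    obtain x y where xy: "P = {x, y}" "x \<noteq> y" using P by (auto simp: card_2_iff)
    then have V: "x \<in> ?V" "y \<in> ?V" using P by auto
    have gd: "gdist G x y = ?d x y" "gdist G y x = ?d x y"
      using gdist_eq_rdist[OF pair_graph_wf[OF assms] V(1)] gdist_eq_rdist[OF pair_graph_wf[OF assms] V(2)] comm[of x y]
      by simp_all
    have "(\<exists>u v. P = {u, v} \<and> d = gdist G u v) \<longleftrightarrow> d = ?d x y" for d
    proof
      assume "\<exists>u v. P = {u, v} \<and> d = gdist G u v"
      then show "d = ?d x y" using xy gd by (auto simp: doubleton_eq_iff)
    next
      assume "d = ?d x y"
      then show "\<exists>u v. P = {u, v} \<and> d = gdist G u v" using xy gd by metis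
    qed
    then have "(THE d. \<exists>u v. P = {u, v} \<and> d = gdist G u v) = ?d x y" by simp
    moreover have "{p \<in> ?S. ?g p = P} = {(x, y), (y, x)}"
      using xy V by (auto simp: doubleton_eq_iff)
    ultimately show ?thesis using xy comm[of x y] by simp
  qed
  have "2 * wiener_index G = (\<Sum>P \<in> ?T. 2 * (THE d. \<exists>u v. P = {u, v} \<and> d = gdist G u v))"
    unfolding wiener_index_def by (simp add: sum_distrib_left)
  also have "\<dots> = (\<Sum>P \<in> ?T. \<Sum>p \<in> {p \<in> ?S. ?g p = P}. case_prod ?d p)"
    using inner by (intro sum.cong) auto
  also have "\<dots> = (\<Sum>p \<in> ?S. case_prod ?d p)"
    by (rule sum.group) (use fin in auto)
  also have "\<dots> = (\<Sum>p \<in> ?V \<times> ?V. case_prod ?d p)"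
    by (rule sum.mono_neutral_left) (use fin in auto)
  finally show ?thesis by (simp add: sum.cartesian_product)
qed

section \<open>Edge sets of cycle lists in terms of positions\<close>

lemma set_vwalk_arcs: "set (vwalk_arcs p) = (\<lambda>i. (p ! i, p ! Suc i)) ` {..<length p - 1}"
  by (induction p rule: vwalk_arcs.induct) (simp_all add: lessThan_Suc_eq_insert_0 image_image)

lemma set_vwalk_arcs_closed:
  assumes "c \<noteq> []"
  shows "set (vwalk_arcs (c @ [hd c])) = (\<lambda>i. (c ! i, c ! (Suc i mod length c))) ` {..<length c}"
proof -
  have "(c @ [hd c]) ! i = c ! i" "(c @ [hd c]) ! Suc i = c ! (Suc i mod length c)"
    if "i < length c" for i
  proof -
    show "(c @ [hd c]) ! i = c ! i" using that by (simp add: nth_append)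
    show "(c @ [hd c]) ! Suc i = c ! (Suc i mod length c)"
    proof (cases "Suc i = length c")
      case True
      then show ?thesis using assms by (simp add: nth_append hd_conv_nth)
    next
      case False
      then show ?thesis using that by (simp add: nth_append)
    qed
  qed
  then show ?thesis unfolding set_vwalk_arcs by (intro image_cong) simp_all
qed

lemma in_cycle_edges_iff:
  assumes "c \<noteq> []"
  shows "(x, y) \<in> cycle_edges c \<longleftrightarrow> (\<exists>i < length c.
    x = c ! i \<and> y = c ! (Suc i mod length c) \<or> y = c ! i \<and> x = c ! (Suc i mod length c))"
  unfolding cycle_edges_def symcl_def set_vwalk_arcs_closed[OF assms] by auto

lemma sym_cycle_edges: "sym (cycle_edges c)"
  unfolding cycle_edges_def symcl_def by (auto intro!: symI)

lemma is_cycle_iff: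
  assumes "pair_wf_digraph G"
  shows "is_cycle G c \<longleftrightarrow> 3 \<le> length c \<and> distinct c \<and>
    (\<forall>i < length c. (c ! i, c ! (Suc i mod length c)) \<in> parcs G)"
proof -
  have "vwalk (c @ [hd c]) (with_proj G) \<longleftrightarrow>
    (\<forall>i < length c. (c ! i, c ! (Suc i mod length c)) \<in> parcs G)" if "c \<noteq> []"
  proof -
    have "set (c @ [hd c]) \<subseteq> pverts G" if "\<forall>i < length c. (c ! i, c ! (Suc i mod length c)) \<in> parcs G"
    proof -
      have "c ! i \<in> pverts G" if "i < length c" for i
        using \<open>\<forall>i < length c. _\<close> that assms by (auto dest: pair_wf_digraph.in_arcsD1)
      then show ?thesis using \<open>c \<noteq> []\<close> by (auto simp: in_set_conv_nth hd_conv_nth)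
    qed
    then show ?thesis using \<open>c \<noteq> []\<close>
      unfolding vwalk_def by (auto simp: set_vwalk_arcs_closed[OF \<open>c \<noteq> []\<close>])
  qed
  then show ?thesis unfolding is_cycle_def by (cases "c = []") auto
qed

lemma is_cycle_iff_edges:
  assumes "pair_graph G"
  shows "is_cycle G c \<longleftrightarrow> 3 \<le> length c \<and> distinct c \<and> cycle_edges c \<subseteq> parcs G"
proof -
  have "cycle_edges c \<subseteq> parcs G \<longleftrightarrow> (\<forall>i < length c. (c ! i, c ! (Suc i mod length c)) \<in> parcs G)"
    if "c \<noteq> []"
    using that by (auto simp: in_cycle_edges_iff subset_iff pair_graph_sym[OF assms])
  then show ?thesis unfolding is_cycle_iff[OF pair_graph_wf[OF assms]] by (cases "c = []") auto
qed

text \<open>Length at least three keeps predecessor and successor apart. The resulting 2-regularity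
  drives both the degree count and the uniqueness of the cycle.\<close>

lemma cycle_neighbours:
  assumes "distinct c" "3 \<le> length c" "i < length c"
  defines "s \<equiv> c ! (Suc i mod length c)" and "p \<equiv> c ! ((i + length c - 1) mod length c)"
  shows "cycle_edges c `` {c ! i} = {s, p}" and "s \<noteq> p"
proof -
  let ?m = "length c"
  have ne: "c \<noteq> []" using assms by auto
  then have "0 < ?m" by simp
  have pred: "(i + ?m - 1) mod ?m = (if i = 0 then ?m - 1 else i - 1)"
    using assms by (auto simp: le_mod_geq)
  have succ: "Suc j mod ?m = (if j = ?m - 1 then 0 else Suc j)" if "j < ?m" for j
    using that by (cases "Suc j = ?m") auto
  show "s \<noteq> p"
    unfolding s_def p_def pred succ[OF assms(3)] using assms(1-3) \<open>0 < ?m\<close>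
    by (auto simp: nth_eq_iff_index_eq split: if_splits)
  let ?p = "(i + ?m - 1) mod ?m"
  have *: "Suc j mod ?m = i \<longleftrightarrow> j = ?p" if "j < ?m" for j
    unfolding pred succ[OF that] using that assms(2,3) by auto
  have "?p < ?m" using \<open>0 < ?m\<close> by (rule mod_less_divisor)
  have "c ! i = c ! j \<longleftrightarrow> i = j" "c ! i = c ! (Suc j mod ?m) \<longleftrightarrow> Suc j mod ?m = i" if "j < ?m" for j
    using nth_eq_iff_index_eq[OF assms(1,3)] that mod_less_divisor[OF \<open>0 < ?m\<close>] by auto
  then have "(c ! i, y) \<in> cycle_edges c \<longleftrightarrow>
      (\<exists>j < ?m. i = j \<and> y = c ! (Suc j mod ?m) \<or> y = c ! j \<and> Suc j mod ?m = i)" for y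
    unfolding in_cycle_edges_iff[OF ne] by (intro ex_cong1 conj_cong refl) auto
  then have "(c ! i, y) \<in> cycle_edges c \<longleftrightarrow> y = s \<or> y = p" for y
    unfolding s_def p_def using * \<open>?p < ?m\<close> assms(3) by blast
  then show "cycle_edges c `` {c ! i} = {s, p}" by auto
qed

lemma Field_cycle_edges:
  assumes "c \<noteq> []"
  shows "Field (cycle_edges c) = set c"
proof
  show "Field (cycle_edges c) \<subseteq> set c"
    using assms by (auto simp: Field_def in_cycle_edges_iff)
  show "set c \<subseteq> Field (cycle_edges c)"
  proof
    fix x assume "x \<in> set c"
    then obtain i where "i < length c" "x = c ! i" by (auto simp: in_set_conv_nth)
    then have "(x, c ! (Suc i mod length c)) \<in> cycle_edges c"
      using assms by (auto simp: in_cycle_edges_iff)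
    then show "x \<in> Field (cycle_edges c)" by (rule FieldI1)
  qed
qed

section \<open>Optimal weights on a cycle\<close>

text \<open>\<open>P\<close> is one open side of the axis of the mirror \<open>\<sigma>\<close>; by
  \<open>dP\<close>, mirroring one of two positions on a side moves it away from the other. The
  rearrangement \<open>b\<close> puts the larger value of each mirror pair on \<open>P\<close>. Its
  energy is at most that of \<open>a\<close>, so optimality forces equality term by term, and
  strictness of \<open>dP\<close> then excludes opposite signs among the odd parts
  \<open>S a\<close> on \<open>P\<close>. Finally \<open>lead\<close> excludes negative
  ones.\<close>

lemma polarized_optimum:
  fixes a g :: "'i \<Rightarrow> int" and d :: "'i \<Rightarrow> 'i \<Rightarrow> int"
  assumes fin: "finite A"
    and \<sigma>: "\<And>i. i \<in> A \<Longrightarrow> \<sigma> i \<in> A" "\<And>i. i \<in> A \<Longrightarrow> \<sigma> (\<sigma> i) = i"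
    and d\<sigma>: "\<And>i j. i \<in> A \<Longrightarrow> j \<in> A \<Longrightarrow> d (\<sigma> i) (\<sigma> j) = d i j"
    and P: "P \<subseteq> A" "\<And>i. i \<in> P \<Longrightarrow> \<sigma> i \<notin> P"
      "\<And>i. i \<in> A \<Longrightarrow> i \<notin> P \<Longrightarrow> \<sigma> i \<notin> P \<Longrightarrow> \<sigma> i = i"
    and dP: "\<And>i j. i \<in> P \<Longrightarrow> j \<in> P \<Longrightarrow> d i j < d i (\<sigma> j)"
    and opt: "\<And>\<pi>. bij_betw \<pi> A A \<Longrightarrow>
      (\<Sum>i\<in>A. \<Sum>j\<in>A. a i * a j * d i j) \<le> (\<Sum>i\<in>A. \<Sum>j\<in>A. a (\<pi> i) * a (\<pi> j) * d i j)"
    and g: "\<And>i. i \<in> P \<Longrightarrow> g (\<sigma> i) < g i"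
    and lead: "(\<Sum>i\<in>A. g i * a (\<sigma> i)) \<le> (\<Sum>i\<in>A. g i * a i)"
    and "i \<in> P"
  shows "a (\<sigma> i) \<le> a i"
proof -
  have bij: "bij_betw \<sigma> A A"
    by (rule bij_betw_byWitness[where f' = \<sigma>]) (use \<sigma> in auto)
  have reindex: "(\<Sum>i\<in>A. f (\<sigma> i)) = (\<Sum>i\<in>A. f i)" for f :: "'i \<Rightarrow> int"
    by (rule sum.reindex_bij_betw[OF bij])
  \<comment> \<open>The second disjunct is the first one read at the mirror position, so
    \<open>\<pi>\<close> moves both members of a pair or neither and is an involution.\<close>
  define \<pi> where "\<pi> i = (if i \<in> P \<and> a i < a (\<sigma> i) \<or> \<sigma> i \<in> P \<and> a (\<sigma> i) < a i then \<sigma> i else i)" for i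
  define b where "b i = a (\<pi> i)" for i
  have \<pi>\<pi>: "\<pi> (\<pi> i) = i" if "i \<in> A" for i
    using that \<sigma>[OF that] P(2) by (auto simp: \<pi>_def)
  have "bij_betw \<pi> A A"
    by (rule bij_betw_byWitness[where f' = \<pi>]) (use \<sigma> \<pi>\<pi> in \<open>auto simp: \<pi>_def\<close>)
  note le = opt[OF this, folded b_def]
  define S :: "('i \<Rightarrow> int) \<Rightarrow> 'i \<Rightarrow> int" where "S x i = x i - x (\<sigma> i)" for x i
  text \<open>
    Averaging the energy over \<open>\<sigma>\<close> in either index gives \<open>Q\<close>. It splits into a product of even parts,
    which \<open>\<pi>\<close> leaves alone, and a product of odd parts \<open>S\<close>, of which \<open>\<pi>\<close> only changes signs.
  \<close>
  define Q where "Q x i j = (x i * x j + x (\<sigma> i) * x (\<sigma> j)) * d i j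
    + (x i * x (\<sigma> j) + x (\<sigma> i) * x j) * d i (\<sigma> j)" for x i j
  have energy: "(\<Sum>i\<in>A. \<Sum>j\<in>A. Q x i j) = 4 * (\<Sum>i\<in>A. \<Sum>j\<in>A. x i * x j * d i j)" for x
  proof -
    let ?E = "\<Sum>i\<in>A. \<Sum>j\<in>A. x i * x j * d i j"
    have d2: "d i (\<sigma> j) = d (\<sigma> i) j" if "i \<in> A" "j \<in> A" for i j
      using d\<sigma>[of i "\<sigma> j"] \<sigma> that by simp
    have 2: "(\<Sum>i\<in>A. \<Sum>j\<in>A. x (\<sigma> i) * x (\<sigma> j) * d i j) = ?E"
    proof -
      have "(\<Sum>i\<in>A. \<Sum>j\<in>A. x (\<sigma> i) * x (\<sigma> j) * d i j)
          = (\<Sum>i\<in>A. \<Sum>j\<in>A. x (\<sigma> i) * x (\<sigma> j) * d (\<sigma> i) (\<sigma> j))"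
        using d\<sigma> by (intro sum.cong) auto
      also have "\<dots> = (\<Sum>i\<in>A. \<Sum>j\<in>A. x (\<sigma> i) * x j * d (\<sigma> i) j)"
        by (intro sum.cong refl reindex)
      also have "\<dots> = ?E" by (rule reindex)
      finally show ?thesis .
    qed
    have 3: "(\<Sum>i\<in>A. \<Sum>j\<in>A. x i * x (\<sigma> j) * d i (\<sigma> j)) = ?E"
      by (intro sum.cong refl reindex)
    have 4: "(\<Sum>i\<in>A. \<Sum>j\<in>A. x (\<sigma> i) * x j * d i (\<sigma> j)) = ?E"
    proof -
      have "(\<Sum>i\<in>A. \<Sum>j\<in>A. x (\<sigma> i) * x j * d i (\<sigma> j))
          = (\<Sum>i\<in>A. \<Sum>j\<in>A. x (\<sigma> i) * x j * d (\<sigma> i) j)"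
        using d2 by (intro sum.cong) auto
      also have "\<dots> = ?E" by (rule reindex)
      finally show ?thesis .
    qed
    show ?thesis using 2 3 4 unfolding Q_def
      by (simp add: distrib_right sum.distrib)
  qed
  have twoQ: "2 * Q x i j = (x i + x (\<sigma> i)) * (x j + x (\<sigma> j)) * (d i j + d i (\<sigma> j))
      + S x i * S x j * (d i j - d i (\<sigma> j))" for x i j
    unfolding Q_def S_def by algebra
  have sums: "b i + b (\<sigma> i) = a i + a (\<sigma> i)" if "i \<in> A" for i
    using that \<sigma>[OF that] P(2) by (auto simp: b_def \<pi>_def)
  have Sa: "S a i = 0" if "i \<in> A" "i \<notin> P" "\<sigma> i \<notin> P" for i
    using P(3)[OF that] by (simp add: S_def)
  have Sb: "S b i = (if i \<in> P then \<bar>S a i\<bar> else if \<sigma> i \<in> P then - \<bar>S a i\<bar> else 0)"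
    if "i \<in> A" for i
  proof (cases "i \<in> P \<or> \<sigma> i \<in> P")
    case True
    then show ?thesis using \<sigma>(2)[OF that] P(2)[of i] P(2)[of "\<sigma> i"]
      by (auto simp: S_def b_def \<pi>_def)
  next
    case False
    then show ?thesis using P(3)[OF that] by (simp add: S_def b_def \<pi>_def)
  qed
  \<comment> \<open>The even parts of \<open>a\<close> and \<open>b\<close> agree by
    \<open>sums\<close>, so only the products of odd parts survive.\<close>
  have diff: "2 * (Q a i j - Q b i j) = (S a i * S a j - S b i * S b j) * (d i j - d i (\<sigma> j))"
    if "i \<in> A" "j \<in> A" for i j
    using twoQ[of a i j] twoQ[of b i j] sums[OF that(1)] sums[OF that(2)]
    by (simp add: algebra_simps)
  have nonneg: "0 \<le> Q a i j - Q b i j" if ij: "i \<in> A" "j \<in> A" for i j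
  proof -
    have abs: "S a i * S a j \<le> \<bar>S a i\<bar> * \<bar>S a j\<bar>" "- (\<bar>S a i\<bar> * \<bar>S a j\<bar>) \<le> S a i * S a j"
      by (auto simp flip: abs_mult)
    have d1: "d i j < d i (\<sigma> j)" if "\<sigma> i \<in> P" "\<sigma> j \<in> P"
    proof -
      have "d (\<sigma> i) (\<sigma> j) < d (\<sigma> i) (\<sigma> (\<sigma> j))" using dP that by simp
      then show ?thesis using d\<sigma> ij \<sigma> by metis
    qed
    have d2: "d i (\<sigma> j) < d i j" if "i \<in> P" "\<sigma> j \<in> P"
      using dP[OF that] \<sigma>(2)[OF ij(2)] by simp
    have d3: "d i (\<sigma> j) < d i j" if "\<sigma> i \<in> P" "j \<in> P"
    proof -
      have "d (\<sigma> i) j < d (\<sigma> i) (\<sigma> j)" using dP that by simp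
      then show ?thesis using d\<sigma> ij \<sigma> by metis
    qed
    have "0 \<le> (S a i * S a j - S b i * S b j) * (d i j - d i (\<sigma> j))"
    proof -
      \<comment> \<open>Positions on the axis have odd part zero. For the other pairs
        \<open>d i j - d i (\<sigma> j)\<close> is negative on the same side and positive across the
        axis.\<close>
      have zero: "k \<in> P \<or> \<sigma> k \<in> P \<or> S a k = 0 \<and> S b k = 0" if "k \<in> A" for k
        using Sa[OF that] Sb[OF that] by auto
      consider "i \<in> P \<and> j \<in> P \<or> \<sigma> i \<in> P \<and> \<sigma> j \<in> P"
        | "i \<in> P \<and> \<sigma> j \<in> P \<or> \<sigma> i \<in> P \<and> j \<in> P"
        | "S a i = 0 \<and> S b i = 0" | "S a j = 0 \<and> S b j = 0"
        using zero[OF ij(1)] zero[OF ij(2)] by blast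
      then show ?thesis
      proof cases
        case 1
        then have "S b i * S b j = \<bar>S a i\<bar> * \<bar>S a j\<bar>"
          using Sb[OF ij(1)] Sb[OF ij(2)] P(2)[of i] P(2)[of j] by auto
        moreover have "d i j < d i (\<sigma> j)" using 1 d1 dP by blast
        ultimately show ?thesis using abs by (intro mult_nonpos_nonpos) auto
      next
        case 2
        then have "S b i * S b j = - (\<bar>S a i\<bar> * \<bar>S a j\<bar>)"
          using Sb[OF ij(1)] Sb[OF ij(2)] P(2)[of i] P(2)[of j] by auto
        moreover have "d i (\<sigma> j) < d i j" using 2 d2 d3 by blast
        ultimately show ?thesis using abs by (intro mult_nonneg_nonneg) auto
      qed simp_all
    qed
    then show ?thesis using diff[OF ij] by simp
  qed
  have "(\<Sum>i\<in>A. \<Sum>j\<in>A. Q a i j - Q b i j) \<le> 0"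
    using le by (simp add: sum_subtractf energy)
  then have "(\<Sum>p\<in>A \<times> A. case p of (i, j) \<Rightarrow> Q a i j - Q b i j) \<le> 0"
    by (simp add: sum.cartesian_product)
  moreover have "0 \<le> (\<Sum>p\<in>A \<times> A. case p of (i, j) \<Rightarrow> Q a i j - Q b i j)"
    by (rule sum_nonneg) (use nonneg in auto)
  ultimately have "(\<Sum>p\<in>A \<times> A. case p of (i, j) \<Rightarrow> Q a i j - Q b i j) = 0" by simp
  then have "\<forall>p\<in>A \<times> A. (case p of (i, j) \<Rightarrow> Q a i j - Q b i j) = 0"
    by (subst (asm) sum_nonneg_eq_0_iff) (use fin nonneg in auto)
  then have Qeq: "Q a i j - Q b i j = 0" if "i \<in> A" "j \<in> A" for i j
    using that by (auto dest!: bspec[of _ _ "(i, j)"])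
  have same_sign: "0 \<le> S a i * S a j" if ij: "i \<in> P" "j \<in> P" for i j
  proof -
    have "i \<in> A" "j \<in> A" using ij P by auto
    then have "(S a i * S a j - S b i * S b j) * (d i j - d i (\<sigma> j)) = 0"
      using Qeq diff by fastforce
    then have "S a i * S a j = S b i * S b j" using dP[OF ij] by simp
    also have "\<dots> = \<bar>S a i\<bar> * \<bar>S a j\<bar>"
      using ij \<open>i \<in> A\<close> \<open>j \<in> A\<close> by (simp add: Sb)
    finally show ?thesis by simp
  qed
  show ?thesis
  proof (rule ccontr)
    assume "\<not> ?thesis"
    then have neg: "S a i < 0" by (simp add: S_def)
    have nonpos: "S a j \<le> 0" if "j \<in> P" for j
      using same_sign[OF \<open>i \<in> P\<close> that] neg by (simp add: zero_le_mult_iff)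
    \<comment> \<open>Pairing the odd part of \<open>g\<close> with that of \<open>a\<close> gives
      twice the gap in \<open>lead\<close>, which would thus be negative.\<close>
    have "(\<Sum>j\<in>A. (g j - g (\<sigma> j)) * S a j) < (\<Sum>j\<in>A. 0)"
    proof (rule sum_strict_mono_ex1)
      show "\<forall>j\<in>A. (g j - g (\<sigma> j)) * S a j \<le> 0"
      proof
        fix j assume j: "j \<in> A"
        consider "j \<in> P" | "\<sigma> j \<in> P" | "S a j = 0" using Sa[OF j] by blast
        then show "(g j - g (\<sigma> j)) * S a j \<le> 0"
        proof cases
          case 1
          then show ?thesis using g[OF 1] nonpos[OF 1] by (simp add: mult_le_0_iff)
        next
          case 2
          then show ?thesis using g[OF 2] nonpos[OF 2] \<sigma>(2)[OF j] by (simp add: S_def mult_le_0_iff)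
        qed simp
      qed
      have "(g i - g (\<sigma> i)) * S a i < 0"
        using g[OF \<open>i \<in> P\<close>] neg by (simp add: mult_less_0_iff)
      then show "\<exists>j\<in>A. (g j - g (\<sigma> j)) * S a j < 0" using \<open>i \<in> P\<close> P(1) by blast
    qed (rule fin)
    moreover have "(\<Sum>j\<in>A. (g j - g (\<sigma> j)) * S a j)
        = 2 * ((\<Sum>j\<in>A. g j * a j) - (\<Sum>j\<in>A. g j * a (\<sigma> j)))"
    proof -
      have "(\<Sum>j\<in>A. g (\<sigma> j) * a (\<sigma> j)) = (\<Sum>j\<in>A. g j * a j)"
        by (rule reindex[of "\<lambda>j. g j * a j"])
      moreover have "(\<Sum>j\<in>A. g (\<sigma> j) * a j) = (\<Sum>j\<in>A. g j * a (\<sigma> j))"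
        using reindex[of "\<lambda>j. g j * a (\<sigma> j)"] \<sigma>(2) by simp
      ultimately show ?thesis
        by (simp add: S_def left_diff_distrib right_diff_distrib sum_subtractf)
    qed
    ultimately show False using lead by simp
  qed
qed

section \<open>Distances and reflections on cyclic positions\<close>

definition cdist :: "nat \<Rightarrow> nat \<Rightarrow> nat \<Rightarrow> nat" where
  "cdist m i j = (let e = (if i \<le> j then j - i else i - j) in min e (m - e))"

text \<open>The reflection \<open>s - i\<close> modulo \<open>m\<close>; the added \<open>m\<close>
  keeps the natural subtraction exact for \<open>i < m\<close>. For \<open>s = 0\<close> the axis
  passes through position 0, for \<open>s = 1\<close> between positions 0 and 1.\<close>

definition cyc_refl :: "nat \<Rightarrow> nat \<Rightarrow> nat \<Rightarrow> nat" where
  "cyc_refl m s i = (m + s - i) mod m"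

lemma cyc_refl_0: "i < m \<Longrightarrow> cyc_refl m 0 i = (if i = 0 then 0 else m - i)"
  by (simp add: cyc_refl_def)

lemma cyc_refl_1:
  assumes "i < m" "2 \<le> m"
  shows "cyc_refl m (Suc 0) i = (if i = 0 then 1 else if i = 1 then 0 else Suc m - i)"
  using assms by (auto simp: cyc_refl_def mod_Suc)

lemma cdist_commute: "cdist m i j = cdist m j i"
  by (simp add: cdist_def)

lemma cdist_self [simp]: "cdist m i i = 0"
  by (simp add: cdist_def)

lemma cdist_bounds:
  "cdist m i j \<le> (j - i) + (i - j)" "cdist m i j \<le> m - ((j - i) + (i - j))"
  by (simp_all add: cdist_def Let_def)

lemma cdist_le: "i \<le> j \<Longrightarrow> cdist m i j = min (j - i) (m - (j - i))"
  by (simp add: cdist_def Let_def)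

text \<open>The cases separate 0 and 1, which are exchanged, from the range where the reflection is
  \<open>m + 1 - i\<close>. Within that range differences are kept; for a pair with one position in
  each range the two arcs trade places, which \<open>min\<close> does not notice.\<close>

lemma cdist_cyc_refl_1:
  assumes "i < m" "j < m" "3 \<le> m"
  shows "cdist m (cyc_refl m (Suc 0) i) (cyc_refl m (Suc 0) j) = cdist m i j"
  using assms(1,2)
proof (induction i j rule: linorder_wlog)
  case (le i j)
  consider "i = j" | "i = 0" "j = 1" | "i = 0" "2 \<le> j" | "i = 1" "2 \<le> j" | "2 \<le> i" "i < j"
    using le by linarith
  then show ?case
  proof cases
    case 3
    have "cdist m (Suc 0) (Suc m - j) = cdist m 0 j"
      using 3 le by (simp add: cdist_le min.commute)
    then show ?thesis using 3 le assms(3) by (simp add: cyc_refl_1)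
  next
    case 4
    have "cdist m 0 (Suc m - j) = cdist m (Suc 0) j"
      using 4 le by (simp add: cdist_le min.commute)
    then show ?thesis using 4 le assms(3) by (simp add: cyc_refl_1)
  next
    case 5
    have "cdist m (Suc m - j) (Suc m - i) = cdist m i j"
      using 5 le by (simp add: cdist_le)
    then show ?thesis using 5 le assms(3) by (simp add: cyc_refl_1 cdist_commute)
  qed (use le assms(3) in \<open>simp_all add: cyc_refl_1 cdist_commute\<close>)
qed (simp add: cdist_commute)

lemma cdist_cyc_refl_0:
  assumes "i < m" "j < m"
  shows "cdist m (cyc_refl m 0 i) (cyc_refl m 0 j) = cdist m i j"
  using assms
proof (induction i j rule: linorder_wlog)
  case (le i j)
  consider "i = j" | "i = 0" "0 < j" | "0 < i" "i < j"
    using le by linarith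
  then show ?case
  proof cases
    case 2
    have "cdist m 0 (m - j) = cdist m 0 j"
      using 2 le by (simp add: cdist_le min.commute)
    then show ?thesis using 2 le by (simp add: cyc_refl_0)
  next
    case 3
    have "cdist m (m - j) (m - i) = cdist m i j"
      using 3 le by (simp add: cdist_le)
    then show ?thesis using 3 le by (simp add: cyc_refl_0 cdist_commute)
  qed simp
qed (simp add: cdist_commute)

text \<open>The two arcs from \<open>i\<close> to the mirror image \<open>m - j\<close> have lengths
  \<open>m - i - j\<close> and \<open>i + j\<close>. Both exceed the difference of \<open>i\<close>
  and \<open>j\<close>, since both positions lie strictly between 0 and half of
  \<open>m\<close>.\<close>

lemma cdist_less_cyc_refl_0:
  assumes "0 < i \<and> 2 * i < m" "0 < j \<and> 2 * j < m"
  shows "cdist m i j < cdist m i (cyc_refl m 0 j)"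
proof -
  have "cyc_refl m 0 j = m - j" using assms by (simp add: cyc_refl_0)
  moreover have "(j - i) + (i - j) < cdist m i (m - j)"
    using assms by (cases "i \<le> j") (simp_all add: cdist_le, linarith+)
  ultimately show ?thesis using cdist_bounds(1)[of m i j] by simp
qed

text \<open>This side runs through the end of the list, where 0 plays the role of \<open>m\<close>.
  Hence 0 is split off, and if exactly one position is 0, the distance is bounded by the arc through
  the end.\<close>

lemma cdist_less_cyc_refl_1:
  assumes "i < m \<and> (i = 0 \<or> m + 1 < 2 * i)" "j < m \<and> (j = 0 \<or> m + 1 < 2 * j)" "3 \<le> m"
  shows "cdist m i j < cdist m i (cyc_refl m (Suc 0) j)"
proof -
  consider "i = 0" "j = 0" | "0 < i" "j = 0" | "i = 0" "0 < j" | "0 < i" "0 < j" by blast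
  then show ?thesis
  proof cases
    case 1
    then show ?thesis using assms(3) by (simp add: cyc_refl_1 cdist_le)
  next
    case 2
    then have "m - i < cdist m (Suc 0) i" using assms(1) by (simp add: cdist_le) linarith
    then show ?thesis
      using 2 assms(3) cdist_bounds(2)[of m i 0] by (simp add: cyc_refl_1 cdist_commute)
  next
    case 3
    then have "m - j < cdist m 0 (Suc m - j)" using assms(2) by (simp add: cdist_le) linarith
    then show ?thesis
      using 3 assms(2,3) cdist_bounds(2)[of m 0 j] by (simp add: cyc_refl_1)
  next
    case 4
    then have "(j - i) + (i - j) < cdist m (Suc m - j) i"
      using assms(1,2) by (cases "i \<le> j") (simp_all add: cdist_le, linarith+)
    then show ?thesis
      using 4 assms(2,3) cdist_bounds(1)[of m i j] by (simp add: cyc_refl_1 cdist_commute)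
  qed
qed

text \<open>The weights \<open>g\<close> decrease along the positions \<open>0, 1, m - 1, 2, m - 2, \<dots>\<close>.\<close>

lemma cyclic_optimum_zigzag:
  fixes a :: "nat \<Rightarrow> int"
  assumes m: "3 \<le> m"
    and opt: "\<And>\<pi>. bij_betw \<pi> {..<m} {..<m} \<Longrightarrow>
      (\<Sum>i<m. \<Sum>j<m. a i * a j * int (cdist m i j))
      \<le> (\<Sum>i<m. \<Sum>j<m. a (\<pi> i) * a (\<pi> j) * int (cdist m i j))"
    and g: "g = (\<lambda>i. if 2 * i \<le> m then 2 * int m + 1 - 2 * int i else 2 * int i)"
    and lead: "\<And>s. s \<le> 1 \<Longrightarrow> (\<Sum>i<m. g i * a (cyc_refl m s i)) \<le> (\<Sum>i<m. g i * a i)"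
  shows "0 < i \<Longrightarrow> 2 * i < m \<Longrightarrow> a (m - i) \<le> a i"
    and "0 < i \<Longrightarrow> 2 * i \<le> m \<Longrightarrow> a i \<le> a (cyc_refl m (Suc 0) i)"
proof -
  show "a (m - i) \<le> a i" if i: "0 < i" "2 * i < m"
  proof -
    \<comment> \<open>Position 0 and, for even \<open>m\<close>, position \<open>m / 2\<close> lie
      on the axis. For \<open>j\<close> in \<open>?P\<close> the weight drops from
      \<open>2 * m + 1 - 2 * j\<close> to \<open>2 * m - 2 * j\<close> under reflection.\<close>
    let ?\<sigma> = "cyc_refl m 0" and ?P = "{i. 0 < i \<and> 2 * i < m}"
    have "a (?\<sigma> i) \<le> a i"
    proof (rule polarized_optimum[where A = "{..<m}" and P = ?P and g = g and \<sigma> = ?\<sigma>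
        and d = "\<lambda>i j. int (cdist m i j)"])
      show "int (cdist m (?\<sigma> i) (?\<sigma> j)) = int (cdist m i j)" if "i \<in> {..<m}" "j \<in> {..<m}" for i j
        using that by (simp add: cdist_cyc_refl_0)
      show "int (cdist m i j) < int (cdist m i (?\<sigma> j))" if "i \<in> ?P" "j \<in> ?P" for i j
        using that by (simp add: cdist_less_cyc_refl_0)
      show "g (?\<sigma> j) < g j" if "j \<in> ?P" for j
        using that by (auto simp: g cyc_refl_0)
      show "(\<Sum>i<m. g i * a (?\<sigma> i)) \<le> (\<Sum>i<m. g i * a i)" by (rule lead) simp
    qed (use i in \<open>auto simp: cyc_refl_0 intro: opt\<close>)
    then show ?thesis using i by (simp add: cyc_refl_0)
  qed
  show "a i \<le> a (cyc_refl m (Suc 0) i)" if i: "0 < i" "2 * i \<le> m"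
  proof -
    \<comment> \<open>For odd \<open>m\<close> the position \<open>(m + 1) / 2\<close> lies on the
      axis. For nonzero \<open>j\<close> in \<open>?P\<close> the weight drops from
      \<open>2 * j\<close> to \<open>2 * j - 1\<close>; this and the other reflection explain the
      odd and even values of \<open>g\<close>.\<close>
    let ?\<sigma> = "cyc_refl m (Suc 0)" and ?P = "{i. i < m \<and> (i = 0 \<or> m + 1 < 2 * i)}"
    have *: "a (?\<sigma> j) \<le> a j" if "j \<in> ?P" for j
    proof (rule polarized_optimum[where A = "{..<m}" and P = ?P and g = g and \<sigma> = ?\<sigma>
        and d = "\<lambda>i j. int (cdist m i j)"])
      show "int (cdist m (?\<sigma> i) (?\<sigma> j)) = int (cdist m i j)" if "i \<in> {..<m}" "j \<in> {..<m}" for i j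
        using that m by (simp add: cdist_cyc_refl_1)
      show "int (cdist m i j) < int (cdist m i (?\<sigma> j))" if "i \<in> ?P" "j \<in> ?P" for i j
        using that m by (intro of_nat_less_iff[THEN iffD2] cdist_less_cyc_refl_1) auto
      show "g (?\<sigma> j) < g j" if "j \<in> ?P" for j
        using that m by (auto simp: g cyc_refl_1)
      show "?\<sigma> (?\<sigma> i) = i" if "i \<in> {..<m}" for i
        using that m by (auto simp: cyc_refl_1)
      show "?\<sigma> i \<notin> ?P" if "i \<in> ?P" for i
        using that m by (auto simp: cyc_refl_1)
      show "?\<sigma> i = i" if "i \<in> {..<m}" "i \<notin> ?P" "?\<sigma> i \<notin> ?P" for i
        using that m by (auto simp: cyc_refl_1 split: if_splits)
      show "(\<Sum>i<m. g i * a (?\<sigma> i)) \<le> (\<Sum>i<m. g i * a i)" by (rule lead) simp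
      show "?\<sigma> i \<in> {..<m}" if "i \<in> {..<m}" for i
        using that by (simp add: cyc_refl_def)
      show "j \<in> ?P" by fact
    qed (auto intro: opt)
    \<comment> \<open>The bound at \<open>i\<close> is \<open>*\<close> applied to its mirror image,
      which lies on the favoured side.\<close>
    have "?\<sigma> i \<in> ?P" "?\<sigma> (?\<sigma> i) = i" using i m by (auto simp: cyc_refl_1)
    then show ?thesis using *[of "?\<sigma> i"] by simp
  qed
qed

text \<open>Two links of the chain lead from \<open>i + 1\<close> through \<open>m - i\<close> to
  \<open>i\<close>, which gives an induction on the lower half; a position in the upper half is
  dominated by its mirror image.\<close>

lemma zigzag_first_max:
  fixes a :: "nat \<Rightarrow> int"
  assumes z1: "\<And>i. 0 < i \<Longrightarrow> 2 * i < m \<Longrightarrow> a (m - i) \<le> a i"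
    and z2: "\<And>i. 0 < i \<Longrightarrow> 2 * i \<le> m \<Longrightarrow> a i \<le> a (cyc_refl m (Suc 0) i)"
    and "i < m"
  shows "a i \<le> a 0"
proof -
  have low: "2 * i \<le> m \<Longrightarrow> a i \<le> a 0" for i
  proof (induction i)
    case (Suc i)
    show ?case
    proof (cases "i = 0")
      case True
      then show ?thesis using z2[of 1] Suc.prems cyc_refl_1[of 1 m] by simp
    next
      case False
      then have "a (Suc i) \<le> a (m - i)" "a (m - i) \<le> a i"
        using z2[of "Suc i"] z1[of i] Suc.prems cyc_refl_1[of "Suc i" m] by auto
      then show ?thesis using Suc by simp
    qed
  qed simp
  show ?thesis
  proof (cases "2 * i \<le> m")
    case False
    then have "a i \<le> a (m - i)" using z1[of "m - i"] \<open>i < m\<close> by simp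
    also have "a (m - i) \<le> a 0" using False by (intro low) simp
    finally show ?thesis .
  qed (rule low)
qed

section \<open>Cycles as sets of edges\<close>

lemma relpow_mono:
  fixes R S :: "'a rel"
  assumes "R \<subseteq> S"
  shows "R ^^ n \<subseteq> S ^^ n"
  using assms by (induction n) auto

text \<open>Walking forward from \<open>i\<close> realises one arc; walking from \<open>j\<close>
  past the end of the list, reversed by symmetry, realises the other. The lower bound holds because
  \<open>cdist\<close> from \<open>i\<close> changes by at most one between consecutive
  positions.\<close>

lemma rdist_cycle_edges:
  assumes "distinct c" "i < length c" "j < length c"
  shows "rdist (cycle_edges c) (c ! i) (c ! j) = cdist (length c) i j"
proof -
  let ?m = "length c" and ?E = "cycle_edges c"
  have ne: "c \<noteq> []" using assms by auto
  have forward: "(c ! i, c ! ((i + n) mod ?m)) \<in> ?E ^^ n" if "i < ?m" for i n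
  proof (induction n)
    case (Suc n)
    have "(c ! ((i + n) mod ?m), c ! (Suc ((i + n) mod ?m) mod ?m)) \<in> ?E"
      unfolding in_cycle_edges_iff[OF ne] using ne by (intro exI[of _ "(i + n) mod ?m"]) simp
    with Suc show ?case by (auto simp: mod_Suc_eq)
  qed (use that in simp)
  have reach: "(c ! i, c ! j) \<in> ?E ^^ cdist ?m i j" if ij: "i \<le> j" "j < ?m" for i j
  proof (cases "j - i \<le> ?m - (j - i)")
    case True
    then show ?thesis using forward[of i "j - i"] ij by (simp add: cdist_le)
  next
    case False
    have "(j + (?m - (j - i))) mod ?m = i" using ij by simp
    then have "(c ! j, c ! i) \<in> ?E ^^ (?m - (j - i))"
      using forward[of j "?m - (j - i)"] ij by simp
    then show ?thesis
      using symD[OF sym_relpow[OF sym_cycle_edges]] False ij by (simp add: cdist_le)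
  qed
  have reach: "(c ! i, c ! j) \<in> ?E ^^ cdist ?m i j"
  proof (cases "i \<le> j")
    case False
    then have "(c ! j, c ! i) \<in> ?E ^^ cdist ?m i j"
      using reach[of j i] assms(2) by (simp add: cdist_commute)
    then show ?thesis by (rule symD[OF sym_relpow[OF sym_cycle_edges]])
  qed (use reach assms in simp)
  define f where "f y = cdist ?m i (inv_into {..<?m} ((!) c) y)" for y
  have f: "f (c ! k) = cdist ?m i k" if "k < ?m" for k
    using inv_into_f_f[of "(!) c" "{..<?m}" k] inj_on_nth[OF assms(1)] that by (simp add: f_def)
  have lip: "cdist ?m i (Suc k mod ?m) \<le> Suc (cdist ?m i k) \<and> cdist ?m i k \<le> Suc (cdist ?m i (Suc k mod ?m))"
    if "k < ?m" for k
  proof -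
    consider "Suc k = ?m" | "Suc k < ?m" "i \<le> k" | "Suc k < ?m" "k < i" using \<open>k < ?m\<close> by linarith
    then show ?thesis
    proof cases
      case 1
      then have "i \<le> k" using assms(2) by simp
      then have "cdist ?m i k = min (k - i) (Suc i)" using 1 by (simp add: cdist_le)
      moreover have "cdist ?m i 0 = min i (?m - i)"
        using cdist_le[of 0 i ?m] by (simp add: cdist_commute)
      ultimately show ?thesis using 1 \<open>i \<le> k\<close> by (auto simp: min_def)
    next
      case 2
      then show ?thesis by (auto simp: cdist_le min_def)
    next
      case 3
      then show ?thesis
        using cdist_le[of k i ?m] cdist_le[of "Suc k" i ?m] by (auto simp: cdist_commute min_def)
    qed
  qed
  have "rdist ?E (c ! i) (c ! j) = f (c ! j)"
  proof (rule rdist_eqI)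
    show "(c ! i, c ! j) \<in> ?E ^^ f (c ! j)" using reach assms by (simp add: f)
    show "f (c ! i) = 0" using assms by (simp add: f)
    show "f v \<le> Suc (f u)" if uv: "(u, v) \<in> ?E" for u v
    proof -
      have "Suc k mod ?m < ?m" for k using ne by simp
      then show ?thesis using uv lip unfolding in_cycle_edges_iff[OF ne] by (auto simp: f)
    qed
  qed
  then show ?thesis using f assms by simp
qed

lemma card_cycle_neighbours:
  assumes "distinct c" "3 \<le> length c" "x \<in> set c"
  shows "finite (cycle_edges c `` {x})" "card (cycle_edges c `` {x}) = 2"
proof -
  obtain i where "i < length c" "x = c ! i" using assms(3) by (auto simp: in_set_conv_nth)
  with cycle_neighbours[OF assms(1,2)]
  show "finite (cycle_edges c `` {x})" "card (cycle_edges c `` {x}) = 2" by simp_all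
qed

lemma cycle_edges_in_set: "(x, y) \<in> cycle_edges c \<Longrightarrow> x \<in> set c \<and> y \<in> set c"
  using Field_cycle_edges[of c] by (cases "c = []") (auto simp: cycle_edges_def symcl_def Field_def)

lemma cycle_edges_irrefl:
  assumes "distinct c" "3 \<le> length c"
  shows "(x, x) \<notin> cycle_edges c"
proof
  assume "(x, x) \<in> cycle_edges c"
  then obtain i where i: "i < length c" "c ! i = c ! (Suc i mod length c)"
    using in_cycle_edges_iff[of c x x] assms(2) by (cases "c = []") auto
  have "0 < length c" using assms(2) by linarith
  then have "i = Suc i mod length c"
    using nth_eq_iff_index_eq[OF assms(1) i(1)] i(2) mod_less_divisor by blast
  then show False using i(1) assms(2) by (cases "Suc i = length c") auto
qed

lemma cycle_edges_connected:
  assumes "distinct c" "x \<in> set c" "y \<in> set c"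
  shows "(x, y) \<in> (cycle_edges c)\<^sup>*"
proof -
  obtain i j where "i < length c" "x = c ! i" "j < length c" "y = c ! j"
    using assms(2,3) by (auto simp: in_set_conv_nth)
  have "(c ! 0, c ! k) \<in> (cycle_edges c)\<^sup>*" if "k < length c" for k
    using that
  proof (induction k)
    case (Suc k)
    then have "(c ! k, c ! Suc k) \<in> cycle_edges c"
      using in_cycle_edges_iff[of c] by (cases "c = []") (auto intro!: exI[of _ k])
    with Suc show ?case by (auto intro: rtrancl_into_rtrancl)
  qed simp
  then have "(c ! 0, x) \<in> (cycle_edges c)\<^sup>*" "(c ! 0, y) \<in> (cycle_edges c)\<^sup>*"
    using \<open>i < length c\<close> \<open>x = c ! i\<close> \<open>j < length c\<close> \<open>y = c ! j\<close> by simp_all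
  then show ?thesis
    using symD[OF sym_rtrancl[OF sym_cycle_edges]] rtrancl_trans by fast
qed

text \<open>Both cycles are 2-regular, so at a vertex of \<open>c'\<close> the inclusion of
  neighbourhoods is an equality. Walks in \<open>c\<close> therefore never leave \<open>c'\<close>,
  and \<open>c\<close> is connected.\<close>

lemma cycle_edges_subset_eq:
  assumes c: "distinct c" "3 \<le> length c" and c': "distinct c'" "3 \<le> length c'"
    and sub: "cycle_edges c' \<subseteq> cycle_edges c"
  shows "cycle_edges c' = cycle_edges c"
proof -
  have "c \<noteq> []" "c' \<noteq> []" using c c' by auto
  then have S: "set c' \<subseteq> set c"
    using mono_Field[OF sub] by (simp add: Field_cycle_edges)
  have nb: "cycle_edges c' `` {x} = cycle_edges c `` {x}" if "x \<in> set c'" for x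
  proof (rule card_subset_eq)
    have "x \<in> set c" using that S by auto
    show "finite (cycle_edges c `` {x})" by (rule card_cycle_neighbours) fact+
    show "card (cycle_edges c' `` {x}) = card (cycle_edges c `` {x})"
      using card_cycle_neighbours(2)[OF c \<open>x \<in> set c\<close>] card_cycle_neighbours(2)[OF c' that] by simp
  qed (use sub in auto)
  obtain x where x: "x \<in> set c'" using \<open>c' \<noteq> []\<close> by (cases c') auto
  have "y \<in> set c'" if "(x, y) \<in> (cycle_edges c)\<^sup>*" for y
    using that
  proof (induction rule: rtrancl_induct)
    case (step y z)
    then have "(y, z) \<in> cycle_edges c'" using nb by auto
    then show ?case by (simp add: cycle_edges_in_set)
  qed (rule x)
  then have "set c \<subseteq> set c'" using cycle_edges_connected[OF c(1)] x S by blast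
  then have "cycle_edges c \<subseteq> cycle_edges c'"
    using nb cycle_edges_in_set by fast
  with sub show ?thesis by simp
qed

lemma cycle_edge_not_bridge:
  assumes "distinct c" "3 \<le> length c" "(x, y) \<in> cycle_edges c"
  shows "(x, y) \<in> (cycle_edges c - {(x, y), (y, x)})\<^sup>*"
proof -
  let ?m = "length c"
  have ne: "c \<noteq> []" using assms by auto
  have main: "(y, x) \<in> (cycle_edges c - {(x, y), (y, x)})\<^sup>*"
    if i: "i < ?m" "x = c ! i" "y = c ! (Suc i mod ?m)" for i x y
  proof -
    \<comment> \<open>After this rotation the edge in question joins the last entry to the first, so
      steps between consecutive entries avoid it.\<close>
    define d where "d = rotate (Suc i) c"
    have d: "distinct d" "length d = ?m" using assms by (simp_all add: d_def)
    have nth: "d ! n = c ! ((Suc i + n) mod ?m)" if "n < ?m" for n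
      unfolding d_def by (rule nth_rotate[OF that])
    have ends: "y = d ! 0" "x = d ! (?m - 1)"
      using i assms(2) ne by (simp_all add: nth)
    have "(d ! 0, d ! n) \<in> (cycle_edges c - {(x, y), (y, x)})\<^sup>*" if "n < ?m" for n
      using that
    proof (induction n)
      case (Suc n)
      have "d ! Suc n = c ! (Suc ((Suc i + n) mod ?m) mod ?m)"
        using nth[OF Suc.prems] by (simp add: mod_Suc_eq)
      moreover have "d ! n = c ! ((Suc i + n) mod ?m)" using nth Suc.prems by simp
      moreover have "(Suc i + n) mod ?m < ?m" using ne by simp
      ultimately have "(d ! n, d ! Suc n) \<in> cycle_edges c"
        unfolding in_cycle_edges_iff[OF ne] by blast
      moreover have "(d ! n, d ! Suc n) \<noteq> (x, y)" "(d ! n, d ! Suc n) \<noteq> (y, x)"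
        unfolding ends using Suc.prems assms(2) d length_greater_0_conv[of c] ne by (auto simp: nth_eq_iff_index_eq)
      ultimately show ?case using Suc by (auto intro: rtrancl_into_rtrancl)
    qed simp
    then show ?thesis using ends ne by simp
  qed
  have "sym (cycle_edges c - {(x, y), (y, x)})"
    using sym_cycle_edges[of c] by (auto simp: sym_def)
  note sym = symD[OF sym_rtrancl[OF this]]
  have swap: "cycle_edges c - {(y, x), (x, y)} = cycle_edges c - {(x, y), (y, x)}" by auto
  from assms(3) obtain i where "i < ?m"
    "x = c ! i \<and> y = c ! (Suc i mod ?m) \<or> y = c ! i \<and> x = c ! (Suc i mod ?m)"
    unfolding in_cycle_edges_iff[OF ne] by blast
  then show ?thesis using main[of i x y] main[of i y x] sym swap by metis
qed

lemma rtrancl_imp_distinct_walk: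
  assumes "(x, y) \<in> R\<^sup>*"
  shows "\<exists>p. p \<noteq> [] \<and> hd p = x \<and> last p = y \<and> distinct p \<and> set (vwalk_arcs p) \<subseteq> R"
  using assms
proof (induction rule: converse_rtrancl_induct)
  case base
  then show ?case by (intro exI[of _ "[y]"]) simp
next
  case (step x z)
  then obtain p where p: "p \<noteq> []" "hd p = z" "last p = y" "distinct p" "set (vwalk_arcs p) \<subseteq> R"
    by blast
  show ?case
  proof (cases "x \<in> set p")
    case True
    then obtain as bs where ab: "p = as @ x # bs" by (auto simp: in_set_conv_decomp)
    have "set (vwalk_arcs (x # bs)) \<subseteq> set (vwalk_arcs p)"
      unfolding ab by (cases "as = []") (auto simp: vwalk_arcs_append)
    then show ?thesis using p ab by (intro exI[of _ "x # bs"]) auto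
  next
    case False
    then show ?thesis using p step(1) by (intro exI[of _ "x # p"]) auto
  qed
qed

text \<open>A distinct walk avoiding the edge is closed up by it. The walk has at least three
  vertices: one vertex would mean \<open>u = v\<close>, and two would use the deleted edge.\<close>

lemma cycle_through_edge:
  assumes G: "pair_graph G" and uv: "(u, v) \<in> parcs G"
    and walk: "(v, u) \<in> (parcs G - {(u, v), (v, u)})\<^sup>*"
  obtains c where "is_cycle G c" "(u, v) \<in> cycle_edges c"
proof -
  obtain p where p: "p \<noteq> []" "hd p = v" "last p = u" "distinct p"
    "set (vwalk_arcs p) \<subseteq> parcs G - {(u, v), (v, u)}"
    using rtrancl_imp_distinct_walk[OF walk] by blast
  have "u \<noteq> v" using G uv by (auto simp: pair_graph_iff)
  have len: "3 \<le> length p"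
  proof (rule ccontr)
    assume "\<not> 3 \<le> length p"
    moreover obtain a q where "p = a # q" using p(1) by (cases p) auto
    ultimately consider "p = [a]" | b where "p = [a, b]" by (cases q; cases "tl q") auto
    then show False using p \<open>u \<noteq> v\<close> by cases auto
  qed
  have arcs: "set (vwalk_arcs (p @ [hd p])) = insert (u, v) (set (vwalk_arcs p))"
    using p(1-3) by (simp add: vwalk_arcs_append)
  have "(u, v) \<in> cycle_edges p"
    unfolding cycle_edges_def symcl_def arcs by simp
  moreover have "cycle_edges p \<subseteq> parcs G"
    unfolding cycle_edges_def symcl_def arcs using p(5) uv by (auto intro: pair_graph_sym[OF G])
  then have "is_cycle G p" using p(4) len by (simp add: is_cycle_iff_edges[OF G])
  ultimately show ?thesis using that by blast
qed

text \<open>The walk is cut at its last visit to \<open>x\<close>. What remains cannot use the edge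
  between \<open>x\<close> and \<open>z\<close> in either direction.\<close>

lemma rtrancl_leave:
  assumes "(x, y) \<in> R\<^sup>*" "x \<noteq> y"
  obtains z where "(x, z) \<in> R" "(z, y) \<in> {(a, b) \<in> R. a \<noteq> x \<and> b \<noteq> x}\<^sup>*"
proof -
  have "y = x \<or> (\<exists>z. (x, z) \<in> R \<and> (z, y) \<in> {(a, b) \<in> R. a \<noteq> x \<and> b \<noteq> x}\<^sup>*)"
    using assms(1)
  proof (induction rule: rtrancl_induct)
    case (step y w)
    show ?case
    proof (cases "y = x \<or> w = x")
      case True
      then show ?thesis using step.hyps(2) by blast
    next
      case False
      then obtain z where z: "(x, z) \<in> R" "(z, y) \<in> {(a, b) \<in> R. a \<noteq> x \<and> b \<noteq> x}\<^sup>*"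
        using step.IH by blast
      have "(y, w) \<in> {(a, b) \<in> R. a \<noteq> x \<and> b \<noteq> x}" using step.hyps(2) False by simp
      then show ?thesis using z rtrancl_into_rtrancl by fast
    qed
  qed simp
  then show ?thesis using assms(2) that by blast
qed

section \<open>Forests completed by a cycle\<close>

lemma sum_over_fibres:
  fixes k :: "'b \<Rightarrow> nat"
  assumes "finite V" "finite S" "r ` V \<subseteq> S"
  shows "(\<Sum>x\<in>V. k (r x)) = (\<Sum>s\<in>S. card {x \<in> V. r x = s} * k s)"
proof -
  have "(\<Sum>x\<in>V. k (r x)) = (\<Sum>s\<in>S. \<Sum>x | x \<in> V \<and> r x = s. k (r x))"
    by (rule sum.group[OF assms, symmetric])
  also have "\<dots> = (\<Sum>s\<in>S. card {x \<in> V. r x = s} * k s)" by simp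
  finally show ?thesis .
qed

text \<open>
  \<open>F\<close> is a forest on \<open>V\<close> each of whose components contains exactly one vertex of \<open>S\<close>, the root of the
  component; \<open>r\<close> maps a vertex to its root. The cycles through \<open>S\<close> in all possible orders are
  the ways of completing \<open>F\<close> to a unicyclic graph without changing degrees.
\<close>

locale rooted_forest =
  fixes V :: "'a set" and F :: "'a rel" and S :: "'a set" and r :: "'a \<Rightarrow> 'a"
  assumes finite_V: "finite V"
    and F_V: "F \<subseteq> V \<times> V"
    and sym_F: "sym F"
    and irrefl_F: "(x, x) \<notin> F"
    and S_V: "S \<subseteq> V"
    and root_S: "x \<in> S \<Longrightarrow> r x = x"
    and root_F: "(x, y) \<in> F \<Longrightarrow> r x = r y"
    and root_in_S: "x \<in> V \<Longrightarrow> r x \<in> S"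
    and to_root: "x \<in> V \<Longrightarrow> (x, r x) \<in> F\<^sup>*"
    and bridge: "(x, y) \<in> F \<Longrightarrow> (x, y) \<notin> (F - {(x, y), (y, x)})\<^sup>*"
begin

lemma finite_S: "finite S"
  using finite_V S_V by (rule finite_subset[rotated])

lemma root_connected: "(x, y) \<in> F\<^sup>* \<Longrightarrow> r x = r y"
  by (induction rule: rtrancl_induct) (auto dest: root_F)

lemma from_root: "x \<in> V \<Longrightarrow> (r x, x) \<in> F\<^sup>*"
  using symD[OF sym_rtrancl[OF sym_F]] to_root by blast

lemma same_root_connected: "x \<in> V \<Longrightarrow> y \<in> V \<Longrightarrow> r x = r y \<Longrightarrow> (x, y) \<in> F\<^sup>*"
  using to_root[of x] from_root[of y] by simp

abbreviation N :: "'a \<Rightarrow> nat" where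
  "N s \<equiv> card {x \<in> V. r x = s}"

end

locale completed_forest = rooted_forest +
  fixes c :: "'a list"
  assumes distinct_c: "distinct c" and length_c: "3 \<le> length c" and set_c: "set c = S"
begin

abbreviation E :: "'a rel" where
  "E \<equiv> cycle_edges c"

abbreviation H :: "'a pair_pre_digraph" where
  "H \<equiv> \<lparr>pverts = V, parcs = F \<union> E\<rparr>"

lemma E_S: "(x, y) \<in> E \<Longrightarrow> x \<in> S \<and> y \<in> S"
  using cycle_edges_in_set set_c by metis

lemma root_E: "(x, y) \<in> E \<Longrightarrow> r x = x \<and> r y = y"
  using E_S root_S by blast

lemma E_neq: "(x, y) \<in> E \<Longrightarrow> x \<noteq> y"
  using cycle_edges_irrefl[OF distinct_c length_c] by blast

text \<open>Forest edges join vertices with a common root, whereas cycle edges join two different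
  roots.\<close>

lemma F_E_disjoint: "F \<inter> E = {}"
  using root_F root_E E_neq by fastforce

lemma E_connected: "x \<in> S \<Longrightarrow> y \<in> S \<Longrightarrow> (x, y) \<in> E\<^sup>*"
  using cycle_edges_connected[OF distinct_c] set_c by metis

lemma pair_graph_H: "pair_graph H"
  unfolding pair_graph_iff
proof (intro conjI allI)
  show "sym (parcs H)" using sym_F sym_cycle_edges[of c] by (simp add: sym_Un)
qed (use F_V S_V E_S finite_V irrefl_F cycle_edges_irrefl[OF distinct_c length_c] in auto)

lemma connected_pair:
  assumes "x \<in> V" "y \<in> V"
  shows "(x, y) \<in> (F \<union> E)\<^sup>*"
proof -
  have "(x, r x) \<in> (F \<union> E)\<^sup>*" "(r y, y) \<in> (F \<union> E)\<^sup>*" "(r x, r y) \<in> (F \<union> E)\<^sup>*"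
    using to_root[OF assms(1)] from_root[OF assms(2)] E_connected[OF root_in_S[OF assms(1)] root_in_S[OF assms(2)]]
      rtrancl_mono[of F "F \<union> E"] rtrancl_mono[of E "F \<union> E"] by auto
  then show ?thesis by (meson rtrancl_trans)
qed

lemma connected_H: "connected (with_proj H)"
  unfolding connected_iff[OF pair_graph_H] using connected_pair S_V set_c length_c by auto

lemma is_cycle_H: "is_cycle H c"
  using distinct_c length_c by (simp add: is_cycle_iff_edges[OF pair_graph_H])

text \<open>
  Contracting everything outside the component of \<open>x\<close> to its root turns a walk in \<open>H\<close> that
  avoids the forest edge \<open>xy\<close> into a walk in \<open>F\<close> that avoids it.
\<close>

lemma forest_edge_bridge:
  assumes "(x, y) \<in> F"
  shows "(x, y) \<notin> ((F \<union> E) - {(x, y), (y, x)})\<^sup>*"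
proof
  assume walk: "(x, y) \<in> ((F \<union> E) - {(x, y), (y, x)})\<^sup>*"
  define p where "p v = (if r v = r x then v else r x)" for v
  have "(p x, p v) \<in> (F - {(x, y), (y, x)})\<^sup>*" if "(x, v) \<in> ((F \<union> E) - {(x, y), (y, x)})\<^sup>*" for v
    using that
  proof (induction rule: rtrancl_induct)
    case (step v w)
    have "p v = p w \<or> (p v, p w) \<in> F - {(x, y), (y, x)}"
    proof (cases "(v, w) \<in> F")
      case True
      then have "r v = r w" by (rule root_F)
      then show ?thesis using True step.hyps(2) by (simp add: p_def)
    next
      case False
      then have "r v = v" "r w = w" using step.hyps(2) root_E[of v w] by simp_all
      then have "p v = r x" "p w = r x" by (simp_all add: p_def)
      then show ?thesis by simp
    qed
    then show ?case
    proof
      assume "p v = p w"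
      then show ?case using step.IH by simp
    next
      assume "(p v, p w) \<in> F - {(x, y), (y, x)}"
      with step.IH show ?case by (rule rtrancl_into_rtrancl)
    qed
  qed simp
  from this[OF walk] have "(x, y) \<in> (F - {(x, y), (y, x)})\<^sup>*"
    using root_F[OF assms] by (simp add: p_def)
  with bridge[OF assms] show False by simp
qed

text \<open>Forest edges are bridges of \<open>H\<close> and no cycle contains a bridge. So every
  cycle lies inside \<open>E\<close>, and a cycle inside a cycle is all of it.\<close>

lemma cycle_edges_unique:
  assumes "is_cycle H c'"
  shows "cycle_edges c' = E"
proof -
  have c': "distinct c'" "3 \<le> length c'" "cycle_edges c' \<subseteq> F \<union> E"
    using assms by (simp_all add: is_cycle_iff_edges[OF pair_graph_H])
  have "(x, y) \<notin> F" if "(x, y) \<in> cycle_edges c'" for x y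
  proof
    assume "(x, y) \<in> F"
    have "(x, y) \<in> ((F \<union> E) - {(x, y), (y, x)})\<^sup>*"
      using cycle_edge_not_bridge[OF c'(1,2) that]
        rtrancl_mono[of "cycle_edges c' - {(x, y), (y, x)}" "(F \<union> E) - {(x, y), (y, x)}"] c'(3)
      by blast
    then show False using forest_edge_bridge[OF \<open>(x, y) \<in> F\<close>] by simp
  qed
  then have "cycle_edges c' \<subseteq> E" using c'(3) by auto
  then show ?thesis by (rule cycle_edges_subset_eq[OF distinct_c length_c c'(1,2)])
qed

lemma cycles_H: "cycles H = {E}"
  unfolding cycles_def using cycle_edges_unique is_cycle_H by blast

lemma unicyclic_H: "unicyclic H"
  unfolding unicyclic_def using pair_graph_H connected_H by (simp add: cycles_H)

lemma the_cycle_H: "the_cycle H = E"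
  unfolding the_cycle_def by (simp add: cycles_H)

lemma girth_H: "girth H = length c"
  unfolding girth_def
proof (rule the_equality)
  show "\<exists>c'. is_cycle H c' \<and> length c' = length c" using is_cycle_H by blast
  fix n assume "\<exists>c'. is_cycle H c' \<and> length c' = n"
  then obtain c' where c': "is_cycle H c'" "length c' = n" by blast
  then have d: "distinct c'" "c' \<noteq> []" "c \<noteq> []" using length_c by (auto simp: is_cycle_def)
  \<comment> \<open>\<open>girth\<close> speaks about lists, so the length has to be recovered from
    the edge set, whose field is the vertex set.\<close>
  then have "set c' = set c"
    using Field_cycle_edges[of c] Field_cycle_edges[of c'] cycle_edges_unique[OF c'(1)] by simp
  then show "n = length c" using c'(2) distinct_card[OF d(1)] distinct_card[OF distinct_c] by simp
qed

text \<open>The right-hand side does not mention \<open>c\<close>, so reordering the roots preserves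
  the degree sequence.\<close>

lemma out_degree_H:
  "out_degree (with_proj H) x = card (F `` {x}) + (if x \<in> S then 2 else 0)"
proof -
  have "out_arcs (with_proj H) x = Pair x ` ((F \<union> E) `` {x})"
    by (auto simp: out_arcs_def)
  then have "out_degree (with_proj H) x = card ((F \<union> E) `` {x})"
    by (simp add: out_degree_def card_image inj_on_def)
  also have "\<dots> = card (F `` {x}) + card (E `` {x})"
  proof -
    have "F `` {x} \<subseteq> V" "E `` {x} \<subseteq> V" using F_V E_S S_V by auto
    then have "finite (F `` {x})" "finite (E `` {x})" using finite_V finite_subset by auto
    moreover have "F `` {x} \<inter> E `` {x} = {}" using F_E_disjoint by auto
    ultimately show ?thesis by (simp add: Un_Image card_Un_disjoint)
  qed
  also have "card (E `` {x}) = (if x \<in> S then 2 else 0)"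
  proof (cases "x \<in> S")
    case True
    then show ?thesis using card_cycle_neighbours(2)[OF distinct_c length_c] set_c by simp
  next
    case False
    then have "E `` {x} = {}" using E_S by auto
    then show ?thesis using False by simp
  qed
  finally show ?thesis .
qed

lemma tree_order_H:
  assumes "x \<in> S"
  shows "tree_order H x = N x"
proof -
  have del: "delete_cycle H = \<lparr>pverts = V, parcs = F\<rparr>"
  proof -
    have "F \<union> E - E = F" using F_E_disjoint by blast
    then show ?thesis by (simp add: delete_cycle_def the_cycle_H)
  qed
  have reach: "u \<rightarrow>\<^sup>*\<^bsub>with_proj (delete_cycle H)\<^esub> v \<longleftrightarrow> (u, v) \<in> F\<^sup>*" if "u \<in> V" for u v
    using rtrancl_on_iff_rtrancl[OF F_V that] by (simp add: reachable_def del)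
  have "x \<in> V" "r x = x" using assms S_V root_S[OF assms] by blast+
  have "pre_digraph.scc_of (with_proj (delete_cycle H)) x = {v \<in> V. r v = x}"
  proof (intro set_eqI iffI)
    fix v assume "v \<in> pre_digraph.scc_of (with_proj (delete_cycle H)) x"
    then have xv: "x \<rightarrow>\<^sup>*\<^bsub>with_proj (delete_cycle H)\<^esub> v" by (simp add: pre_digraph.scc_of_def)
    then have "v \<in> V" by (auto simp: del elim: reachable_in_vertsE)
    then show "v \<in> {v \<in> V. r v = x}"
      using xv reach[OF \<open>x \<in> V\<close>] root_connected[of x v] \<open>r x = x\<close> by simp
  next
    fix v assume "v \<in> {v \<in> V. r v = x}"
    then have v: "v \<in> V" "r v = x" by simp_all
    have "(x, v) \<in> F\<^sup>*" using from_root[OF v(1)] v(2) by simp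
    moreover have "(v, x) \<in> F\<^sup>*" using to_root[OF v(1)] v(2) by simp
    ultimately show "v \<in> pre_digraph.scc_of (with_proj (delete_cycle H)) x"
      using reach v(1) \<open>x \<in> V\<close> by (simp add: pre_digraph.scc_of_def)
  qed
  then show ?thesis unfolding tree_order_def attached_tree_def by simp
qed

text \<open>A shortest walk inside one tree may avoid the root, hence the two cases. The lower bound
  uses the formula itself as the function in \<open>rdist_eqI\<close>.\<close>

lemma rdist_H:
  assumes x: "x \<in> V" and y: "y \<in> V"
  shows "rdist (F \<union> E) x y = (if r x = r y then rdist F x y
    else rdist F x (r x) + rdist E (r x) (r y) + rdist F (r y) y)"
proof -
  define f where "f z = (if r x = r z then rdist F x z
    else rdist F x (r x) + rdist E (r x) (r z) + rdist F (r z) z)" for z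
  have lift: "(u, v) \<in> (F \<union> E) ^^ n" if "(u, v) \<in> F ^^ n \<or> (u, v) \<in> E ^^ n" for u v n
    using that relpow_mono[of F "F \<union> E" n] relpow_mono[of E "F \<union> E" n] by auto
  have reach: "(x, y) \<in> (F \<union> E) ^^ f y"
  proof (cases "r x = r y")
    case True
    then show ?thesis
      using relpow_rdist[OF same_root_connected[OF x y True]] lift by (simp add: f_def)
  next
    case False
    have "(x, r x) \<in> (F \<union> E) ^^ rdist F x (r x)" "(r y, y) \<in> (F \<union> E) ^^ rdist F (r y) y"
      "(r x, r y) \<in> (F \<union> E) ^^ rdist E (r x) (r y)"
      using relpow_rdist[OF to_root[OF x]] relpow_rdist[OF from_root[OF y]]
        relpow_rdist[OF E_connected[OF root_in_S[OF x] root_in_S[OF y]]] lift by simp_all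
    then have "(x, y) \<in> (F \<union> E) ^^ (rdist F x (r x) + rdist E (r x) (r y) + rdist F (r y) y)"
      unfolding relpow_add by (intro relcompI)
    then show ?thesis using False by (simp add: f_def)
  qed
  have "f v \<le> Suc (f u)" if uv: "(u, v) \<in> F \<union> E" for u v
  proof (cases "(u, v) \<in> F")
    case True
    then have V: "u \<in> V" "v \<in> V" and "r u = r v" using F_V root_F by auto
    moreover have "rdist F x v \<le> Suc (rdist F x u)" if "r x = r u"
      by (rule rdist_step[OF same_root_connected[OF x V(1) that] True])
    moreover have "rdist F (r u) v \<le> Suc (rdist F (r u) u)"
      by (rule rdist_step[OF from_root[OF V(1)] True])
    ultimately show ?thesis by (cases "r x = r u") (simp_all add: f_def)
  next
    case False
    then have e: "(u, v) \<in> E" using uv by simp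
    then have r: "r u = u" "r v = v" and S: "u \<in> S" "v \<in> S" using root_E E_S by auto
    have "rdist E (r x) v \<le> Suc (rdist E (r x) u)"
      by (rule rdist_step[OF E_connected[OF root_in_S[OF x] S(1)] e])
    \<comment> \<open>At a root both branches of \<open>f\<close> coincide, since the distance from
      a root to itself is zero; a cycle step is therefore judged by a single formula.\<close>
    moreover have "f z = rdist F x (r x) + rdist E (r x) z" if "r z = z" for z
      using that by (cases "r x = z") (simp_all add: f_def)
    ultimately show ?thesis using r by simp
  qed
  then have "rdist (F \<union> E) x y = f y"
    using reach by (intro rdist_eqI) (auto simp: f_def)
  then show ?thesis by (simp add: f_def)
qed

lemma wiener_index_H:
  "2 * wiener_index H =
    (\<Sum>x\<in>V. \<Sum>y\<in>V. if r x = r y then rdist F x y else rdist F x (r x) + rdist F (r y) y)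
    + (\<Sum>i<length c. \<Sum>j<length c. N (c ! i) * N (c ! j) * cdist (length c) i j)"
proof -
  have fibres: "r ` V \<subseteq> S" using root_in_S by auto
  have by_index: "(\<Sum>s\<in>S. h s) = (\<Sum>i<length c. h (c ! i))" for h :: "'a \<Rightarrow> nat"
    using sum.reindex_bij_betw[OF bij_betw_nth[OF distinct_c refl refl], of h] set_c by simp
  have "2 * wiener_index H = (\<Sum>x\<in>V. \<Sum>y\<in>V. rdist (F \<union> E) x y)"
    using wiener_index_double_sum[OF pair_graph_H] by simp
  \<comment> \<open>For equal roots the cycle distance is zero, so it can be split off from both
    branches. The rest does not depend on \<open>c\<close>.\<close>
  also have "\<dots> = (\<Sum>x\<in>V. \<Sum>y\<in>V. (if r x = r y then rdist F x y else rdist F x (r x) + rdist F (r y) y)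
      + rdist E (r x) (r y))"
    by (intro sum.cong refl) (simp add: rdist_H)
  also have "\<dots> = (\<Sum>x\<in>V. \<Sum>y\<in>V. if r x = r y then rdist F x y else rdist F x (r x) + rdist F (r y) y)
      + (\<Sum>x\<in>V. \<Sum>y\<in>V. rdist E (r x) (r y))"
    by (simp add: sum.distrib)
  also have "(\<Sum>x\<in>V. \<Sum>y\<in>V. rdist E (r x) (r y))
      = (\<Sum>s\<in>S. N s * (\<Sum>t\<in>S. N t * rdist E s t))"
    using sum_over_fibres[OF finite_V finite_S fibres]
    by simp
  also have "\<dots> = (\<Sum>i<length c. \<Sum>j<length c. N (c ! i) * N (c ! j) * rdist E (c ! i) (c ! j))"
    by (simp add: by_index sum_distrib_left mult.assoc)
  also have "\<dots> = (\<Sum>i<length c. \<Sum>j<length c. N (c ! i) * N (c ! j) * cdist (length c) i j)"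
    by (simp add: rdist_cycle_edges[OF distinct_c])
  finally show ?thesis .
qed

end

section \<open>Optimal unicyclic graphs\<close>

text \<open>Bridges and uniqueness of roots both rest on \<open>no_walk\<close>: an edge off the
  cycle whose ends stay connected without it would lie on a second cycle.\<close>

lemma unicyclic_decomposition:
  assumes uni: "unicyclic G" and cyc: "is_cycle G c"
  obtains r where "completed_forest (pverts G) (parcs G - cycle_edges c) (set c) r c"
proof -
  have G: "pair_graph G" using uni by (simp add: unicyclic_def)
  let ?V = "pverts G" and ?E = "cycle_edges c" and ?S = "set c"
  define F where "F = parcs G - ?E"
  have c: "3 \<le> length c" "distinct c" "?E \<subseteq> parcs G"
    using cyc by (simp_all add: is_cycle_iff_edges[OF G])
  have parcs: "parcs G = F \<union> ?E" using c(3) by (auto simp: F_def)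
  have parcs_V: "parcs G \<subseteq> ?V \<times> ?V" using G by (simp add: pair_graph_iff)
  have S_V: "?S \<subseteq> ?V" using cyc by (auto simp: is_cycle_def vwalk_def)
  have symF: "sym F"
    unfolding F_def
  proof (rule symI)
    fix x y assume xy: "(x, y) \<in> parcs G - ?E"
    then have "(y, x) \<notin> ?E" using symD[OF sym_cycle_edges, of y x c] by blast
    then show "(y, x) \<in> parcs G - ?E" using xy pair_graph_sym[OF G, of x y] by blast
  qed
  note symF' = symD[OF sym_rtrancl[OF symF]]
  have no_walk: False if f: "(x, y) \<in> F" and walk: "(y, x) \<in> (parcs G - {(x, y), (y, x)})\<^sup>*" for x y
  proof -
    have "(x, y) \<in> parcs G" using f by (simp add: F_def)
    then obtain c' where c': "is_cycle G c'" "(x, y) \<in> cycle_edges c'"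
      by (rule cycle_through_edge[OF G _ walk])
    moreover have "cycle_edges c' = ?E"
    proof -
      have "cycle_edges c' \<in> cycles G" "?E \<in> cycles G" using c'(1) cyc by (auto simp: cycles_def)
      then show ?thesis using uni unfolding unicyclic_def by blast
    qed
    ultimately show False using f by (simp add: F_def)
  qed
  have ex_root: "\<exists>s \<in> ?S. (x, s) \<in> F\<^sup>*" if x: "x \<in> ?V" for x
  proof -
    obtain t where t: "t \<in> ?S" using c(1) by (cases c) auto
    then have tV: "t \<in> ?V" using S_V by blast
    have "(x, t) \<in> (parcs G)\<^sup>*"
      using uni x tV by (simp add: unicyclic_def connected_iff[OF G])
    then show ?thesis
    proof (induction rule: converse_rtrancl_induct)
      case (step y z)
      show ?case
      proof (cases "(y, z) \<in> F")
        case True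
        then show ?thesis using step.IH by (blast intro: converse_rtrancl_into_rtrancl)
      next
        case False
        \<comment> \<open>An arc outside \<open>F\<close> is a cycle edge, so the walk has already
          reached a root.\<close>
        then have "y \<in> ?S" using step.hyps(1) cycle_edges_in_set[of y z c] by (simp add: parcs)
        then show ?thesis by blast
      qed
    qed (use t in blast)
  qed
  have unique_root: "s = t" if st: "s \<in> ?S" "t \<in> ?S" "(s, t) \<in> F\<^sup>*" for s t
  proof (rule ccontr)
    assume "s \<noteq> t"
    \<comment> \<open>The forest walk after its last visit to \<open>s\<close>, followed by a way
      back along the cycle, connects the ends of the forest edge \<open>(s, z)\<close> without using
      it.\<close>
    then obtain z where z: "(s, z) \<in> F" "(z, t) \<in> {(a, b) \<in> F. a \<noteq> s \<and> b \<noteq> s}\<^sup>*"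
      using rtrancl_leave[OF st(3)] by blast
    let ?R = "parcs G - {(s, z), (z, s)}"
    have "{(a, b) \<in> F. a \<noteq> s \<and> b \<noteq> s} \<subseteq> ?R" by (auto simp: F_def)
    from subsetD[OF rtrancl_mono[OF this] z(2)] have zt: "(z, t) \<in> ?R\<^sup>*" .
    have "(z, s) \<in> F" using symD[OF symF z(1)] .
    then have "?E \<subseteq> ?R" using z(1) c(3) by (auto simp: F_def)
    from subsetD[OF rtrancl_mono[OF this] cycle_edges_connected[OF c(2) st(2,1)]]
    have "(t, s) \<in> ?R\<^sup>*" .
    with zt have "(z, s) \<in> ?R\<^sup>*" by (rule rtrancl_trans)
    then show False by (rule no_walk[OF z(1)])
  qed
  define r where "r x = (SOME s. s \<in> ?S \<and> (x, s) \<in> F\<^sup>*)" for x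
  have r: "r x \<in> ?S" "(x, r x) \<in> F\<^sup>*" if "x \<in> ?V" for x
    using someI_ex[of "\<lambda>s. s \<in> ?S \<and> (x, s) \<in> F\<^sup>*"] ex_root[OF that] unfolding r_def by blast+
  have "completed_forest ?V F ?S r c"
  proof
    show "finite ?V" using G by (simp add: pair_graph_iff)
    show "F \<subseteq> ?V \<times> ?V" using parcs_V by (auto simp: F_def)
    show "(x, x) \<notin> F" for x using G by (simp add: F_def pair_graph_iff)
    show "r x = x" if "x \<in> ?S" for x
    proof -
      have "x \<in> ?V" using that S_V by blast
      then show ?thesis using unique_root[OF that r] by simp
    qed
    show "r x = r y" if xy: "(x, y) \<in> F" for x y
    proof -
      have V: "x \<in> ?V" "y \<in> ?V" using xy parcs_V by (auto simp: F_def)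
      have "(r x, x) \<in> F\<^sup>*" by (rule symF'[OF r(2)[OF V(1)]])
      also note xy
      also note r(2)[OF V(2)]
      finally show ?thesis by (rule unique_root[OF r(1)[OF V(1)] r(1)[OF V(2)]])
    qed
    show "(x, y) \<notin> (F - {(x, y), (y, x)})\<^sup>*" if xy: "(x, y) \<in> F" for x y
    proof
      assume walk: "(x, y) \<in> (F - {(x, y), (y, x)})\<^sup>*"
      have "sym (F - {(x, y), (y, x)})" using symF unfolding sym_def by blast
      from symD[OF sym_rtrancl[OF this] walk] have walk': "(y, x) \<in> (F - {(x, y), (y, x)})\<^sup>*" .
      have "F - {(x, y), (y, x)} \<subseteq> parcs G - {(x, y), (y, x)}" by (auto simp: F_def)
      from no_walk[OF xy subsetD[OF rtrancl_mono[OF this] walk']] show False .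
    qed
    show "sym F" by (rule symF)
    show "set c \<subseteq> ?V" by (rule S_V)
    show "r x \<in> ?S" "(x, r x) \<in> F\<^sup>*" if "x \<in> ?V" for x
      using r[OF that] by simp_all
  qed (simp_all add: c)
  then show ?thesis using that unfolding F_def by blast
qed

section \<open>Reflections and relabellings of cycle lists\<close>

lemma cyc_refl_lt: "0 < m \<Longrightarrow> cyc_refl m s i < m"
  by (simp add: cyc_refl_def)

lemma cyc_refl_involution:
  assumes "3 \<le> m" "s \<le> 1" "i < m"
  shows "cyc_refl m s (cyc_refl m s i) = i"
proof -
  consider "s = 0" | "s = Suc 0" using assms(2) by linarith
  then show ?thesis
    using assms(1,3) by cases (auto simp: cyc_refl_0 cyc_refl_1)
qed

text \<open>This is \<open>s - (i + 1) + 1 = s - i\<close> modulo \<open>m\<close>: the reflected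
  list runs through the cycle backwards.\<close>

lemma cyc_refl_Suc:
  assumes "3 \<le> m" "s \<le> 1" "i < m"
  shows "Suc (cyc_refl m s (Suc i mod m)) mod m = cyc_refl m s i"
proof -
  consider "s = 0" | "s = Suc 0" using assms(2) by linarith
  then show ?thesis
  proof cases
    case 1
    show ?thesis
    proof (cases "Suc i = m")
      case True
      then have "i \<noteq> 0" "m - i = Suc 0" using assms(1) by linarith+
      then show ?thesis using True 1 assms(1) by (simp add: cyc_refl_0)
    next
      case False
      then have "Suc i < m" using assms(3) by simp
      moreover from this have "Suc (m - Suc i) = m - i" by linarith
      ultimately show ?thesis using 1 by (cases "i = 0") (simp_all add: cyc_refl_0)
    qed
  next
    case 2
    show ?thesis
    proof (cases "Suc i = m")
      case True
      then have "i \<noteq> 0" "i \<noteq> 1" "Suc m - i = 2" using assms(1) by linarith+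
      then show ?thesis using True 2 assms(1) by (simp add: cyc_refl_1)
    next
      case False
      then have "Suc i < m" using assms(3) by simp
      moreover from this have "Suc (Suc m - Suc i) = Suc m - i" by linarith
      ultimately show ?thesis using 2 assms(1)
        by (cases "i = 0"; cases "i = 1") (simp_all add: cyc_refl_1)
    qed
  qed
qed

lemma is_cycle_reflect:
  assumes G: "pair_graph G" and "is_cycle G c" and "s \<le> 1"
  shows "is_cycle G (map (\<lambda>i. c ! cyc_refl (length c) s i) [0..<length c])" (is "is_cycle G ?c")
proof -
  let ?m = "length c" and ?\<rho> = "cyc_refl (length c) s"
  have c: "3 \<le> ?m" "distinct c" "\<forall>i < ?m. (c ! i, c ! (Suc i mod ?m)) \<in> parcs G"
    using assms(2) unfolding is_cycle_iff[OF pair_graph_wf[OF G]] by blast+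
  have pos: "0 < ?m" using c(1) by linarith
  have lt: "?\<rho> i < ?m" for i using pos by (rule cyc_refl_lt)
  have "inj_on (\<lambda>i. c ! ?\<rho> i) {0..<?m}"
  proof (rule inj_onI)
    fix i j assume ij: "i \<in> {0..<?m}" "j \<in> {0..<?m}" "c ! ?\<rho> i = c ! ?\<rho> j"
    have inv: "?\<rho> (?\<rho> i) = i" "?\<rho> (?\<rho> j) = j"
      using cyc_refl_involution[OF c(1) assms(3)] ij(1,2) by simp_all
    have "?\<rho> i = ?\<rho> j" using ij(3) unfolding nth_eq_iff_index_eq[OF c(2) lt lt] .
    from arg_cong[OF this, of ?\<rho>] show "i = j" unfolding inv .
  qed
  then have "distinct ?c" unfolding distinct_map by simp
  moreover have "(?c ! i, ?c ! (Suc i mod length ?c)) \<in> parcs G" if "i < length ?c" for i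
  proof -
    have i: "i < ?m" using that by simp
    have "Suc i mod ?m < ?m" using pos by (rule mod_less_divisor)
    with i have nth: "?c ! i = c ! ?\<rho> i" "?c ! (Suc i mod length ?c) = c ! ?\<rho> (Suc i mod ?m)"
      by simp_all
    have "(c ! ?\<rho> (Suc i mod ?m), c ! ?\<rho> i) \<in> parcs G"
      using c(3)[rule_format, OF lt, of "Suc i mod ?m"] unfolding cyc_refl_Suc[OF c(1) assms(3) i] .
    then show ?thesis unfolding nth by (rule pair_graph_sym[OF G])
  qed
  moreover have "3 \<le> length ?c" using c(1) by simp
  ultimately show ?thesis unfolding is_cycle_iff[OF pair_graph_wf[OF G]] by blast
qed

text \<open>\<open>u j\<close> is the entry at \<open>1 - j\<close> modulo the length, so
  \<open>u\<close> starts at position 0 and then moves backwards from the end. \<open>q\<close> is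
  the first position after the \<open>w\<close> block; \<open>q = k + 1\<close> and
  \<open>q = k\<close> give the two parities.\<close>

lemma zigzag_list:
  assumes "length c + 1 = q + k" "1 \<le> k" "1 \<le> q" "2 \<le> length c"
  defines "u \<equiv> \<lambda>j. c ! cyc_refl (length c) (Suc 0) j"
  shows "[u 1] @ map (\<lambda>j. c ! j) [1..<q] @ rev (map u [2..<k + 1]) = c"
proof (rule nth_equalityI)
  let ?l = "[u 1] @ map (\<lambda>j. c ! j) [1..<q] @ rev (map u [2..<k + 1])"
  show len: "length ?l = length c" using assms(1-3) by simp linarith
  fix i assume "i < length ?l"
  then have i: "i < length c" using len by simp
  consider "i = 0" | "0 < i" "i < q" | "q \<le> i" by linarith
  then show "?l ! i = c ! i"
  proof cases
    case 1
    then show ?thesis using assms(4) by (simp add: u_def cyc_refl_def)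
  next
    case 2
    then have "i - 1 < q - 1" by linarith
    with 2 show ?thesis by (simp add: nth_append nth_Cons')
  next
    case 3
    have "?l ! i = rev (map u [2..<k + 1]) ! (i - q)"
      using 3 assms(3) by (simp add: nth_append nth_Cons') linarith
    also have "\<dots> = u (length c + 1 - i)"
    proof -
      have "Suc (Suc (k - Suc (Suc (i - q)))) = q + k - i" using 3 i assms(1) by linarith
      then show ?thesis using 3 i assms(1,2) by (simp add: rev_nth del: upt_Suc)
    qed
    also have "\<dots> = c ! i"
      using 3 i assms(3,4) by (auto simp: u_def cyc_refl_def)
    finally show ?thesis .
  qed
qed

lemma optimal_cycle_zigzag:
  fixes G :: "'a pair_pre_digraph"
  assumes G: "G \<in> unicyclic_graphs D \<gamma>"
    and opt: "\<forall>H :: 'a pair_pre_digraph \<in> unicyclic_graphs D \<gamma>. wiener_index G \<le> wiener_index H"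
  shows "\<exists>c. is_cycle G c \<and> length c = \<gamma> \<and> Field (the_cycle G) = set c \<and>
    (\<forall>i. 0 < i \<and> 2 * i < \<gamma> \<longrightarrow> tree_order G (c ! (\<gamma> - i)) \<le> tree_order G (c ! i)) \<and>
    (\<forall>i. 0 < i \<and> 2 * i \<le> \<gamma> \<longrightarrow>
      tree_order G (c ! i) \<le> tree_order G (c ! cyc_refl \<gamma> (Suc 0) i)) \<and>
    (\<forall>x \<in> set c. tree_order G x \<le> tree_order G (c ! 0))"
proof -
  have uni: "unicyclic G" and deg: "has_degree_sequence G D" and girth: "girth G = \<gamma>"
    using G by (simp_all add: unicyclic_graphs_def)
  have pg: "pair_graph G" using uni by (simp add: unicyclic_def)
  obtain c0 where c0: "is_cycle G c0" using uni by (auto simp: unicyclic_def cycles_def)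
  define V F S where "V = pverts G" and "F = parcs G - cycle_edges c0" and "S = set c0"
  obtain r where r: "completed_forest V F S r c0"
    using unicyclic_decomposition[OF uni c0] unfolding V_def F_def S_def by blast
  have "cycle_edges c0 \<subseteq> parcs G" using c0 by (simp add: is_cycle_iff_edges[OF pg])
  then have G0: "G = \<lparr>pverts = V, parcs = F \<union> cycle_edges c0\<rparr>"
    unfolding V_def F_def by (intro pair_pre_digraph.equality) auto
  have len0: "length c0 = \<gamma>" using completed_forest.girth_H[OF r] girth G0 by simp
  have \<gamma>: "3 \<le> \<gamma>" using completed_forest.length_c[OF r] len0 by simp
  have length_enum: "length c = \<gamma>" if "distinct c" "set c = S" for c
    using distinct_card[OF that(1)] distinct_card[OF completed_forest.distinct_c[OF r]] that(2) len0
    by (simp add: S_def)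
  have cf: "completed_forest V F S r c" if "distinct c" "set c = S" for c
    using r that length_enum[OF that] \<gamma>
    unfolding completed_forest_def completed_forest_axioms_def by simp
  have edges: "cycle_edges c = cycle_edges c0" if "is_cycle G c" for c
    using completed_forest.cycle_edges_unique[OF r] that G0 by simp
  have enum: "distinct c" "set c = S" "length c = \<gamma>" if "is_cycle G c" for c
  proof -
    show d: "distinct c" using that by (simp add: is_cycle_def)
    have "c \<noteq> []" "c0 \<noteq> []" using that c0 by (auto simp: is_cycle_def)
    then show "set c = S"
      using Field_cycle_edges[of c] Field_cycle_edges[of c0] edges[OF that] by (simp add: S_def)
    with d show "length c = \<gamma>" by (rule length_enum)
  qed
  define N where "N s = card {x \<in> V. r x = s}" for s
  \<comment> \<open>All listings \<open>c\<close> of the cycle of \<open>G\<close> have the same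
    edges, so \<open>G\<close> and its competitor differ only in the cycle list, and the first
    summand of \<open>wiener_index_H\<close> cancels.\<close>
  have energy: "(\<Sum>i<\<gamma>. \<Sum>j<\<gamma>. N (c ! i) * N (c ! j) * cdist \<gamma> i j)
      \<le> (\<Sum>i<\<gamma>. \<Sum>j<\<gamma>. N (c' ! i) * N (c' ! j) * cdist \<gamma> i j)"
    if c: "is_cycle G c" and c': "distinct c'" "set c' = S" for c c'
  proof -
    have Gc: "G = \<lparr>pverts = V, parcs = F \<union> cycle_edges c\<rparr>" using G0 edges[OF c] by simp
    note C = cf[OF enum(1,2)[OF c]] and C' = cf[OF c']
    note len = enum(3)[OF c] length_enum[OF c']
    let ?H = "\<lparr>pverts = V, parcs = F \<union> cycle_edges c'\<rparr>"
    have "out_degree (with_proj ?H) = out_degree (with_proj G)"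
      unfolding Gc using completed_forest.out_degree_H[OF C] completed_forest.out_degree_H[OF C']
      by (intro ext) simp
    then have "has_degree_sequence ?H D" using deg by (simp add: has_degree_sequence_def V_def)
    then have "?H \<in> unicyclic_graphs D \<gamma>"
      using completed_forest.unicyclic_H[OF C'] completed_forest.girth_H[OF C'] len
      by (simp add: unicyclic_graphs_def)
    then have "2 * wiener_index G \<le> 2 * wiener_index ?H" using opt by simp
    then show ?thesis
      unfolding N_def using completed_forest.wiener_index_H[OF C] completed_forest.wiener_index_H[OF C'] len
      by (simp flip: Gc)
  qed
  define g where "g i = (if 2 * i \<le> \<gamma> then 2 * int \<gamma> + 1 - 2 * int i else 2 * int i)" for i
  define \<Phi> where "\<Phi> c = (\<Sum>i<\<gamma>. g i * int (N (c ! i)))" for c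
  have "{c. is_cycle G c} \<subseteq> {c. set c \<subseteq> S \<and> length c = \<gamma>}" using enum by blast
  moreover have "finite {c. set c \<subseteq> S \<and> length c = \<gamma>}"
    by (rule finite_lists_length_eq) (simp add: S_def)
  ultimately have "finite {c. is_cycle G c}" by (rule finite_subset)
  then have "Max (\<Phi> ` {c. is_cycle G c}) \<in> \<Phi> ` {c. is_cycle G c}" and
    Max: "\<And>c. is_cycle G c \<Longrightarrow> \<Phi> c \<le> Max (\<Phi> ` {c. is_cycle G c})"
    using c0 by (auto intro!: Max_in)
  then obtain c where c: "is_cycle G c" and max: "\<And>c'. is_cycle G c' \<Longrightarrow> \<Phi> c' \<le> \<Phi> c" by auto
  note C = enum[OF c]
  define a where "a i = int (N (c ! i))" for i
  have opt_a: "(\<Sum>i<\<gamma>. \<Sum>j<\<gamma>. a i * a j * int (cdist \<gamma> i j))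
      \<le> (\<Sum>i<\<gamma>. \<Sum>j<\<gamma>. a (\<pi> i) * a (\<pi> j) * int (cdist \<gamma> i j))"
    if \<pi>: "bij_betw \<pi> {..<\<gamma>} {..<\<gamma>}" for \<pi>
  proof -
    \<comment> \<open>The permutation of weights is realised by a competitor: \<open>?c\<close>
      enumerates the roots and need not be a cycle of \<open>G\<close>.\<close>
    let ?c = "map (\<lambda>i. c ! \<pi> i) [0..<\<gamma>]"
    have bij: "bij_betw (\<lambda>i. c ! \<pi> i) {..<\<gamma>} S"
      using bij_betw_trans[OF \<pi> bij_betw_nth[of c "{..<\<gamma>}" S]] C by (simp add: comp_def)
    have "distinct ?c" "set ?c = S"
      using bij by (auto simp: distinct_map bij_betw_def atLeast0LessThan)
    from energy[OF c this] have "(\<Sum>i<\<gamma>. \<Sum>j<\<gamma>. N (c ! i) * N (c ! j) * cdist \<gamma> i j)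
      \<le> (\<Sum>i<\<gamma>. \<Sum>j<\<gamma>. N (c ! \<pi> i) * N (c ! \<pi> j) * cdist \<gamma> i j)" by simp
    then have "int (\<Sum>i<\<gamma>. \<Sum>j<\<gamma>. N (c ! i) * N (c ! j) * cdist \<gamma> i j)
      \<le> int (\<Sum>i<\<gamma>. \<Sum>j<\<gamma>. N (c ! \<pi> i) * N (c ! \<pi> j) * cdist \<gamma> i j)"
      by (rule of_nat_mono)
    then show ?thesis by (simp add: a_def)
  qed
  \<comment> \<open>The reflected list is again a listing of the cycle of \<open>G\<close>, so
    maximality of \<open>\<Phi>\<close> applies to it.\<close>
  have lead: "(\<Sum>i<\<gamma>. g i * a (cyc_refl \<gamma> s i)) \<le> (\<Sum>i<\<gamma>. g i * a i)" if "s \<le> 1" for s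
    using max[OF is_cycle_reflect[OF pg c that]] C by (simp add: \<Phi>_def a_def)
  have g_eq: "g = (\<lambda>i. if 2 * i \<le> \<gamma> then 2 * int \<gamma> + 1 - 2 * int i else 2 * int i)"
    by (rule ext) (simp add: g_def)
  have z1: "a (\<gamma> - i) \<le> a i" if "0 < i" "2 * i < \<gamma>" for i
    by (rule cyclic_optimum_zigzag(1)[OF \<gamma> opt_a g_eq lead]) (use that in simp_all)
  have z2: "a i \<le> a (cyc_refl \<gamma> (Suc 0) i)" if "0 < i" "2 * i \<le> \<gamma>" for i
    by (rule cyclic_optimum_zigzag(2)[OF \<gamma> opt_a g_eq lead]) (use that in simp_all)
  have tree: "tree_order G x = N x" if "x \<in> S" for x
    using completed_forest.tree_order_H[OF r that] G0 by (simp add: N_def)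
  have tree_a: "int (tree_order G (c ! i)) = a i" if "i < \<gamma>" for i
    using tree[of "c ! i"] C that nth_mem[of i c] by (simp add: a_def)
  show ?thesis
  proof (intro exI[of _ c] conjI allI impI ballI; (elim conjE)?)
    show "is_cycle G c" by (rule c)
    show "length c = \<gamma>" using C by simp
    have "the_cycle G = cycle_edges c0" using completed_forest.the_cycle_H[OF r] G0 by simp
    moreover have "c0 \<noteq> []" using len0 \<gamma> by auto
    ultimately show "Field (the_cycle G) = set c" using C by (simp add: Field_cycle_edges S_def)
    show "tree_order G (c ! (\<gamma> - i)) \<le> tree_order G (c ! i)" if "0 < i" "2 * i < \<gamma>" for i
      using z1[OF that] tree_a[of i] tree_a[of "\<gamma> - i"] that by simp
    show "tree_order G (c ! i) \<le> tree_order G (c ! cyc_refl \<gamma> (Suc 0) i)"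
      if "0 < i" "2 * i \<le> \<gamma>" for i
      using z2[OF that] tree_a[of i] tree_a[of "cyc_refl \<gamma> (Suc 0) i"] cyc_refl_lt[of \<gamma>] that
      by simp
    show "tree_order G x \<le> tree_order G (c ! 0)" if "x \<in> set c" for x
    proof -
      obtain i where i: "i < \<gamma>" "x = c ! i" using \<open>x \<in> set c\<close> C by (auto simp: in_set_conv_nth)
      have "a i \<le> a 0" by (rule zigzag_first_max[OF z1 z2 i(1)])
      then show ?thesis using tree_a[of i] tree_a[of 0] i by simp
    qed
  qed
qed

theorem mainTheorem2:
  fixes G :: "'a pair_pre_digraph" and D :: "nat list" and \<gamma> :: nat
  assumes "G \<in> unicyclic_graphs D \<gamma>"
    and "\<forall>H :: 'a pair_pre_digraph \<in> unicyclic_graphs D \<gamma>. wiener_index G \<le> wiener_index H"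
  shows "(\<forall>k. \<gamma> = 2 * k \<longrightarrow>
            (\<exists>u w :: nat \<Rightarrow> 'a.
               is_cycle G ([u 1] @ map w [1..<k + 1] @ rev (map u [2..<k + 1])) \<and>
               (\<forall>x \<in> Field (the_cycle G). tree_order G x \<le> tree_order G (u 1)) \<and>
               (\<forall>i \<in> {1..k}. tree_order G (u i) \<ge> tree_order G (w i)) \<and>
               (\<forall>i \<in> {1..<k}. tree_order G (w i) \<ge> tree_order G (u (i + 1))))) \<and>
         (\<forall>k. \<gamma> = 2 * k - 1 \<longrightarrow>
            (\<exists>u w :: nat \<Rightarrow> 'a.
               is_cycle G ([u 1] @ map w [1..<k] @ rev (map u [2..<k + 1])) \<and>
               (\<forall>x \<in> Field (the_cycle G). tree_order G x \<le> tree_order G (u 1)) \<and>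
               (\<forall>i \<in> {1..<k}. tree_order G (u i) \<ge> tree_order G (w i)) \<and>
               (\<forall>i \<in> {1..<k}. tree_order G (w i) \<ge> tree_order G (u (i + 1)))))"
proof -
  obtain c where c: "is_cycle G c" "length c = \<gamma>" "Field (the_cycle G) = set c"
    and down: "\<forall>i. 0 < i \<and> 2 * i < \<gamma> \<longrightarrow> tree_order G (c ! (\<gamma> - i)) \<le> tree_order G (c ! i)"
    and up: "\<forall>i. 0 < i \<and> 2 * i \<le> \<gamma> \<longrightarrow>
      tree_order G (c ! i) \<le> tree_order G (c ! cyc_refl \<gamma> (Suc 0) i)"
    and first: "\<forall>x \<in> set c. tree_order G x \<le> tree_order G (c ! 0)"
    using optimal_cycle_zigzag[OF assms] by (elim exE conjE)
  \<comment> \<open>This excludes \<open>k = 0\<close>, where \<open>2 * k - 1\<close> would be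
    truncated to 0.\<close>
  have \<gamma>: "3 \<le> \<gamma>" using c by (simp add: is_cycle_def)
  define u w where "u j = c ! cyc_refl \<gamma> (Suc 0) j" and "w j = c ! j" for j
  have list: "[u 1] @ map w [1..<q] @ rev (map u [2..<k + 1]) = c"
    if "\<gamma> + 1 = q + k" "1 \<le> k" "1 \<le> q" for k q
    using zigzag_list[of c q k] that c(2) \<gamma> unfolding u_def w_def by simp
  have "u 1 = c ! 0" by (simp add: u_def cyc_refl_def)
  then have max: "\<forall>x \<in> Field (the_cycle G). tree_order G x \<le> tree_order G (u 1)"
    using first c(3) by simp
  have uw: "tree_order G (w i) \<le> tree_order G (u i)" if "0 < i" "2 * i \<le> \<gamma>" for i
    using up that by (simp add: u_def w_def)
  have wu: "tree_order G (u (i + 1)) \<le> tree_order G (w i)" if "0 < i" "2 * i < \<gamma>" for i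
    using down that by (simp add: u_def w_def cyc_refl_def)
  have even: "is_cycle G ([u 1] @ map w [1..<k + 1] @ rev (map u [2..<k + 1]))"
    "\<forall>i \<in> {1..k}. tree_order G (w i) \<le> tree_order G (u i)"
    "\<forall>i \<in> {1..<k}. tree_order G (u (i + 1)) \<le> tree_order G (w i)" if "\<gamma> = 2 * k" for k
  proof -
    show "is_cycle G ([u 1] @ map w [1..<k + 1] @ rev (map u [2..<k + 1]))"
      using list[of "k + 1" k] that \<gamma> c(1) by simp
    show "\<forall>i \<in> {1..k}. tree_order G (w i) \<le> tree_order G (u i)"
      by (rule ballI, rule uw) (use that in \<open>simp_all, linarith?\<close>)
    show "\<forall>i \<in> {1..<k}. tree_order G (u (i + 1)) \<le> tree_order G (w i)"
      by (rule ballI, rule wu) (use that in \<open>simp_all, linarith?\<close>)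
  qed
  have odd: "is_cycle G ([u 1] @ map w [1..<k] @ rev (map u [2..<k + 1]))"
    "\<forall>i \<in> {1..<k}. tree_order G (w i) \<le> tree_order G (u i)"
    "\<forall>i \<in> {1..<k}. tree_order G (u (i + 1)) \<le> tree_order G (w i)" if "\<gamma> = 2 * k - 1" for k
  proof -
    show "is_cycle G ([u 1] @ map w [1..<k] @ rev (map u [2..<k + 1]))"
      using list[of k k] that \<gamma> c(1) by simp
    show "\<forall>i \<in> {1..<k}. tree_order G (w i) \<le> tree_order G (u i)"
      by (rule ballI, rule uw) (use that in \<open>simp_all, linarith?\<close>)
    show "\<forall>i \<in> {1..<k}. tree_order G (u (i + 1)) \<le> tree_order G (w i)"
      by (rule ballI, rule wu) (use that in \<open>simp_all, linarith?\<close>)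
  qed
  show ?thesis
  proof (intro conjI allI impI, goal_cases)
    case (1 k)
    show ?case by (rule exI[of _ u], rule exI[of _ w]) (intro conjI even[OF 1] max)
  next
    case (2 k)
    show ?case by (rule exI[of _ u], rule exI[of _ w]) (intro conjI odd[OF 2] max)
  qed
qed

end
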